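(* Let $\varphi:[0,\infty)\to[0,\infty)$ be a non-increasing function such that, for some $\mu>0$ and $\nu>0$, the function $t\mapsto e^{\nu t}\varphi(t)$ is non-decreasing on $[0,\infty)$, and the integral $\int_0^\infty e^{zt}\,d\varphi(t)$ converges for all $z\in\mathbb{C}$ with $0<\operatorname{Re} z<\mu$. Suppose also that there exist $j>0$ and functions $F,H$ holomorphic on $\{0<\operatorname{Re} z\le\mu\}$ such that $$\int_0^\infty e^{zt}\varphi(t)\,dt=\frac{F(z)}{(\mu-z)^j}+H(z),\qquad 0<\operatorname{Re} z<\mu$$ (in particular the integral on the left converges for these $z$). Then $$\varphi(t)\sim\frac{F(\mu)}{\Gamma(j)}\,t^{j-1}e^{-\mu t},\qquad t\to\infty,$$ that is, $\lim_{t\to\infty}\varphi(t)\,t^{1-j}e^{\mu t}=F(\mu)/\Gamma(j)$.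
   Context: The integral $\int_0^\infty e^{zt}\,d\varphi(t)$ is a (possibly improper) Riemann–Stieltjes integral with respect to the monotone function $\varphi$, and integrals over $[0,\infty)$ are understood as limits of integrals over $[0,R]$ as $R\to\infty$. A function is holomorphic on the non-open set $\{0<\operatorname{Re} z\le\mu\}$ if it is holomorphic on an open neighbourhood of that set. For $\operatorname{Re} z<\mu$, the power $(\mu-z)^j$ is taken with the principal branch. $\Gamma$ is Euler's Gamma function. *)

theory Defs
  imports "HOL-Complex_Analysis.Complex_Analysis"
begin

text \<open>
  Riemann--Stieltjes integral of \<open>f\<close> with respect to \<open>g\<close> over \<open>[a, b]\<close> (for \<open>a \<le> b\<close>), as the
  limit of the sums over tagged partitions \<open>a = x\<^sub>0 \<le> \<dots> \<le> x\<^sub>n = b\<close> with tags \<open>\<xi>\<^sub>i \<in> [x\<^sub>i, x\<^sub>i\<^sub>+\<^sub>1]\<close> when the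
  mesh tends to 0.
\<close>

definition has_RS_integral ::
  "(real \<Rightarrow> 'a::real_normed_vector) \<Rightarrow> (real \<Rightarrow> real) \<Rightarrow> real \<Rightarrow> real \<Rightarrow> 'a \<Rightarrow> bool"
where
  "has_RS_integral f g a b I \<longleftrightarrow>
     (\<forall>e>0. \<exists>d>0. \<forall>(n::nat) x \<xi>.
        x 0 = a \<and> x n = b \<and>
        (\<forall>i<n. x i \<le> \<xi> i \<and> \<xi> i \<le> x (Suc i) \<and> x (Suc i) - x i < d) \<longrightarrow>
        norm ((\<Sum>i<n. (g (x (Suc i)) - g (x i)) *\<^sub>R f (\<xi> i)) - I) < e)"

definition has_improper_RS_integral ::
  "(real \<Rightarrow> 'a::real_normed_vector) \<Rightarrow> (real \<Rightarrow> real) \<Rightarrow> 'a \<Rightarrow> bool"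
where
  "has_improper_RS_integral f g L \<longleftrightarrow>
     (\<exists>J. (\<forall>R\<ge>0. has_RS_integral f g 0 R (J R)) \<and> (J \<longlongrightarrow> L) at_top)"

definition has_improper_integral :: "(real \<Rightarrow> 'a::real_normed_vector) \<Rightarrow> 'a \<Rightarrow> bool"
where
  "has_improper_integral f L \<longleftrightarrow>
     (\<forall>R\<ge>0. f integrable_on {0..R}) \<and> ((\<lambda>R. integral {0..R} f) \<longlongrightarrow> L) at_top"

end

theory Submission
  imports Defs "HOL-Probability.Sinc_Integral" "HOL-Real_Asymp.Real_Asymp"
begin

text \<open>
  Put \<open>b t = t * exp (\<mu> t) * \<phi> t\<close>. The factor \<open>t\<close> raises the order of the singularity of the Laplace
  transform at 0 to \<open>j + 1 > 1\<close>; its leading term there is that of \<open>c t\<^sup>j\<close> with \<open>c = F \<mu> / \<Gamma> j\<close>, and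
  the difference of the two transforms is \<open>O(\<bar>s\<bar>\<^sup>-\<^sup>j)\<close> in \<open>{0 < Re s < \<mu> / 2}\<close> for bounded \<open>Im s\<close>.
  By Fubini, integrating \<open>b t * exp (- t / x)\<close> against a Fejer kernel centred at \<open>x\<close> amounts to
  integrating the transform over a bounded segment of the line \<open>Re s = 1 / x\<close>. Tying the abscissa to \<open>x\<close>
  makes the contribution of the difference \<open>o(x\<^sup>j)\<close> by dominated convergence, so the local averages of
  \<open>b\<close> at \<open>x\<close> are asymptotic to \<open>c x\<^sup>j\<close>. The two monotonicity assumptions bound \<open>b t / b s\<close> between
  exponentials of \<open>\<plusminus>\<kappa> (t - s)\<close>, and concentrating the kernel turns averages into pointwise asymptotics.
\<close>

section \<open>The Fejer kernel\<close>

text \<open>Fourier transform of the tent \<open>1 - \<bar>y\<bar>\<close> on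
  \<open>{-1..1}\<close>, see \<open>fejer_fourier\<close>; at scale \<open>h\<close> it therefore
  sees only frequencies up to \<open>1 / h\<close>.\<close>

definition fejer :: "real \<Rightarrow> real" where
  "fejer u = (sinc (u / 2))\<^sup>2"

lemma fejer_nonneg: "0 \<le> fejer u"
  by (simp add: fejer_def)

lemma fejer_measurable [measurable]: "fejer \<in> borel_measurable borel"
proof -
  have "(\<lambda>u. (sinc (u / 2))\<^sup>2) \<in> borel_measurable borel"
    by (rule borel_measurable_power, rule measurable_compose[OF _ borel_measurable_sinc]) simp
  then show ?thesis by (simp add: fejer_def[abs_def])
qed

text \<open>An integrable majorant. With \<open>v = u / 2\<close>, the bounds
  \<open>v\<^sup>2\<close> and \<open>1\<close> for \<open>(sin v)\<^sup>2\<close> take care of the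
  summands \<open>1\<close> and \<open>v\<^sup>2\<close> of \<open>1 + v\<^sup>2\<close>.\<close>

lemma fejer_le: "fejer u \<le> 2 * inverse (1 + (u / 2)\<^sup>2)"
proof (cases "u = 0")
  case False
  define v where "v = u / 2"
  have v: "v \<noteq> 0" using False by (simp add: v_def)
  have "(sin v)\<^sup>2 \<le> v\<^sup>2"
    using abs_sin_x_le_abs_x[of v] by (simp add: abs_le_square_iff)
  moreover have "(sin v)\<^sup>2 \<le> 1"
    by (simp add: abs_square_le_1)
  ultimately have "(sin v)\<^sup>2 * (1 + v\<^sup>2) \<le> 2 * v\<^sup>2"
    using mult_right_mono[of "(sin v)\<^sup>2" 1 "v\<^sup>2"] by (simp add: algebra_simps)
  moreover have "1 + v\<^sup>2 > 0" by (simp add: add_pos_nonneg)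
  ultimately have "(sin v / v)\<^sup>2 \<le> 2 * inverse (1 + v\<^sup>2)"
    using v by (simp add: field_simps power_divide)
  then show ?thesis using v by (simp add: fejer_def v_def)
qed (simp add: fejer_def)

lemma fejer_le_2: "fejer u \<le> 2"
proof -
  have "inverse (1 + (u / 2)\<^sup>2) \<le> 1"
    by (simp add: inverse_le_1_iff)
  then show ?thesis using fejer_le[of u] by linarith
qed

lemma integrable_fejer: "integrable lborel fejer"
proof (rule Bochner_Integration.integrable_bound)
  have "integrable lborel (\<lambda>x::real. inverse (1 + x\<^sup>2))"
    using integrable_inverse_1_plus_square by (simp add: set_integrable_def)
  from lborel_integrable_real_affine[OF this, of "1/2" 0]
  show "integrable lborel (\<lambda>u::real. 2 * inverse (1 + (u / 2)\<^sup>2))"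
    by simp
  show "AE u in lborel. norm (fejer u) \<le> norm (2 * inverse (1 + (u / 2)\<^sup>2))"
    using fejer_le fejer_nonneg by (auto simp: abs_of_nonneg intro!: AE_I2)
qed simp

text \<open>This constant is divided out later. Were it zero, the kernel would vanish almost
  everywhere, yet it is nonzero on an interval of measure 1.\<close>

lemma fejer_integral_pos: "0 < (\<integral>u. fejer u \<partial>lborel)"
proof (rule ccontr)
  assume "\<not> ?thesis"
  moreover have "0 \<le> (\<integral>u. fejer u \<partial>lborel)"
    by (intro integral_nonneg_AE AE_I2 fejer_nonneg)
  ultimately have "(\<integral>u. fejer u \<partial>lborel) = 0"
    by linarith
  then have "AE u in lborel. fejer u = 0"
    using integral_nonneg_eq_0_iff_AE[OF integrable_fejer] fejer_nonneg by simp
  moreover have "fejer u \<noteq> 0" if "u \<in> {0<..<1}" for u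
    using that sin_gt_zero[of "u / 2"] pi_gt3 by (auto simp: fejer_def)
  ultimately have "AE u in lborel. u \<notin> {0<..<1::real}"
    by (auto elim!: eventually_mono)
  then have "emeasure lborel {0<..<1::real} = 0"
    by (subst (asm) AE_iff_measurable[of "{0<..<1::real}"]) auto
  then show False by simp
qed

text \<open>Supplies windows \<open>{-T..T}\<close> that carry all but an arbitrarily small fraction
  of the mass.\<close>

lemma fejer_truncated_tendsto:
  "((\<lambda>T. \<integral>u. indicator {-T..T} u * fejer u \<partial>lborel) \<longlongrightarrow> (\<integral>u. fejer u \<partial>lborel)) at_top"
proof (rule integral_dominated_convergence_at_top[where w = fejer])
  show "AE u in lborel. ((\<lambda>T. indicator {-T..T} u * fejer u) \<longlongrightarrow> fejer u) at_top"
  proof (rule AE_I2, rule tendsto_eventually)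
    fix u :: real
    show "\<forall>\<^sub>F T in at_top. indicator {-T..T} u * fejer u = fejer u"
      using eventually_ge_at_top[of "\<bar>u\<bar>"] by eventually_elim (auto simp: indicator_def)
  qed
  show "\<forall>\<^sub>F T in at_top. AE u in lborel. norm (indicator {-T..T} u * fejer u) \<le> fejer u"
    by (auto simp: indicator_def fejer_nonneg)
qed (use integrable_fejer in auto)

text \<open>Explicit antiderivatives on each side of the kink of the tent at \<open>y = 0\<close>.
  The case \<open>u = 0\<close> is separate because the general antiderivatives divide by
  \<open>w\<close>.\<close>

lemma fejer_fourier:
  "(LINT y:{-1..1}|lborel. complex_of_real (1 - \<bar>y\<bar>) * exp (\<i> * complex_of_real (y * u)))
    = complex_of_real (fejer u)"
proof -
  let ?f = "\<lambda>y. complex_of_real (1 - \<bar>y\<bar>) * exp (\<i> * complex_of_real (y * u))"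
  have "set_integrable lborel {-1..1} ?f"
    by (intro borel_integrable_atLeastAtMost' continuous_intros)
  then have eq: "(LINT y:{-1..1}|lborel. ?f y) = integral {-1..1} ?f"
    by (rule set_borel_integral_eq_integral)
  have "(?f has_integral complex_of_real (fejer u)) {-1..1}"
  proof (cases "u = 0")
    case True
    let ?P = "\<lambda>z::complex. z + z\<^sup>2 / 2" and ?Q = "\<lambda>z::complex. z - z\<^sup>2 / 2"
    have P: "(?P has_field_derivative 1 + z) (at z)"
      and Q: "(?Q has_field_derivative 1 - z) (at z)" for z
      by (auto intro!: derivative_eq_intros)
    have "(?f has_integral (?P (of_real 0) - ?P (of_real (-1)))) {-1..0}"
    proof (rule fundamental_theorem_of_calculus)
      fix y :: real assume "y \<in> {-1..0}"
      then show "((\<lambda>y. ?P (of_real y)) has_vector_derivative ?f y) (at y within {-1..0})"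
        using has_vector_derivative_real_field[OF P[of "of_real y"]] by (simp add: True)
    qed simp
    moreover have "(?f has_integral (?Q (of_real 1) - ?Q (of_real 0))) {0..1}"
    proof (rule fundamental_theorem_of_calculus)
      fix y :: real assume "y \<in> {0..1}"
      then show "((\<lambda>y. ?Q (of_real y)) has_vector_derivative ?f y) (at y within {0..1})"
        using has_vector_derivative_real_field[OF Q[of "of_real y"]] by (simp add: True)
    qed simp
    ultimately have "(?f has_integral 1 / 2 + 1 / 2) {-1..1}"
      by (intro has_integral_combine[of "-1" 0 1]) (auto simp: field_simps)
    then show ?thesis by (simp add: True fejer_def)
  next
    case False
    define w where "w = \<i> * complex_of_real u"
    have w: "w \<noteq> 0" using False by (simp add: w_def)
    \<comment> \<open>Antiderivatives of \<open>(1 + z) * exp (w * z)\<close> and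
      \<open>(1 - z) * exp (w * z)\<close>, found by integration by parts.\<close>
    let ?P = "\<lambda>z. (1 + z) * exp (w * z) / w - exp (w * z) / w\<^sup>2"
    let ?Q = "\<lambda>z. (1 - z) * exp (w * z) / w + exp (w * z) / w\<^sup>2"
    have P: "(?P has_field_derivative (1 + z) * exp (w * z)) (at z)"
      and Q: "(?Q has_field_derivative (1 - z) * exp (w * z)) (at z)" for z
      using w by (auto intro!: derivative_eq_intros simp: field_simps power2_eq_square)
    have f: "?f y = (1 + of_real y) * exp (w * of_real y)" if "y \<le> 0" for y
      using that by (simp add: w_def mult_ac)
    have f': "?f y = (1 - of_real y) * exp (w * of_real y)" if "y \<ge> 0" for y
      using that by (simp add: w_def mult_ac)
    have "(?f has_integral (?P (of_real 0) - ?P (of_real (-1)))) {-1..0}"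
    proof (rule fundamental_theorem_of_calculus)
      fix y :: real assume "y \<in> {-1..0}"
      then show "((\<lambda>y. ?P (of_real y)) has_vector_derivative ?f y) (at y within {-1..0})"
        by (subst f) (auto intro: has_vector_derivative_real_field[OF P])
    qed simp
    moreover have "(?f has_integral (?Q (of_real 1) - ?Q (of_real 0))) {0..1}"
    proof (rule fundamental_theorem_of_calculus)
      fix y :: real assume "y \<in> {0..1}"
      then show "((\<lambda>y. ?Q (of_real y)) has_vector_derivative ?f y) (at y within {0..1})"
        by (subst f') (auto intro: has_vector_derivative_real_field[OF Q])
    qed simp
    ultimately have "(?f has_integral
        ((?P (of_real 0) - ?P (of_real (-1))) + (?Q (of_real 1) - ?Q (of_real 0)))) {-1..1}"
      by (intro has_integral_combine[of "-1" 0 1]) auto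
    \<comment> \<open>The factors \<open>1 + z\<close> and \<open>1 - z\<close> vanish at the outer
      endpoints, and the two terms \<open>1 / w\<close> at 0 cancel.\<close>
    also have "(?P (of_real 0) - ?P (of_real (-1))) + (?Q (of_real 1) - ?Q (of_real 0))
        = (exp w + exp (-w) - 2) / w\<^sup>2"
      using w by (simp add: field_simps)
    also have "exp w + exp (-w) = 2 * cos (of_real u)"
      by (simp add: w_def cos_exp_eq)
    also have "(2 * cos (complex_of_real u) - 2) / w\<^sup>2 = complex_of_real ((2 - 2 * cos u) / u\<^sup>2)"
      using False by (simp add: w_def power_mult_distrib cos_of_real field_simps)
    also have "(2 - 2 * cos u) / u\<^sup>2 = fejer u"
      using False cos_double_sin[of "u / 2"] by (simp add: fejer_def power_divide field_simps)
    finally show ?thesis .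
  qed
  then show ?thesis
    using eq by (simp add: integral_unique)
qed

section \<open>Laplace transforms\<close>

definition laplace :: "(real \<Rightarrow> real) \<Rightarrow> complex \<Rightarrow> complex" where
  "laplace f s = (LINT t:{0..}|lborel. complex_of_real (f t) * exp (- (s * complex_of_real t)))"

text \<open>Absolute convergence is required on all of \<open>Re s > 0\<close> and nothing on the
  boundary. The class is then closed under multiplication by \<open>t\<close>, hence under
  differentiating transforms.\<close>

definition laplace_convergent :: "(real \<Rightarrow> real) \<Rightarrow> bool" where
  "laplace_convergent f \<longleftrightarrow> f \<in> borel_measurable borel \<and>
     (\<forall>\<sigma>>0. set_integrable lborel {0..} (\<lambda>t. f t * exp (- (\<sigma> * t))))"

lemma laplace_convergentD:
  assumes "laplace_convergent f"
  shows "f \<in> borel_measurable borel"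
    and "\<sigma> > 0 \<Longrightarrow> set_integrable lborel {0..} (\<lambda>t. f t * exp (- (\<sigma> * t)))"
  using assms by (auto simp: laplace_convergent_def)

lemma laplace_integrable:
  assumes "laplace_convergent f" and "Re s > 0"
  shows "set_integrable lborel {0..} (\<lambda>t. complex_of_real (f t) * exp (- (s * complex_of_real t)))"
proof -
  note [measurable] = laplace_convergentD(1)[OF assms(1)]
  show ?thesis
    unfolding set_integrable_def
    by (rule Bochner_Integration.integrable_bound
              [OF laplace_convergentD(2)[OF assms, unfolded set_integrable_def]])
       (auto simp: indicator_def norm_mult)
qed

text \<open>Half of the damping absorbs the new factor, as
  \<open>t * exp (- (\<sigma> / 2 * t)) \<le> 2 / \<sigma>\<close>; \<open>f\<close> is still
  integrable against the other half.\<close>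

lemma laplace_convergent_times:
  assumes "laplace_convergent f"
  shows "laplace_convergent (\<lambda>t. t * f t)"
proof -
  note [measurable] = laplace_convergentD(1)[OF assms]
  have "set_integrable lborel {0..} (\<lambda>t. t * f t * exp (- (\<sigma> * t)))" if \<sigma>: "\<sigma> > 0" for \<sigma> :: real
  proof -
    have int: "integrable lborel (\<lambda>t. 2 / \<sigma> * (indicator {0..} t *\<^sub>R (f t * exp (- (\<sigma> / 2 * t)))))"
      using laplace_convergentD(2)[OF assms, of "\<sigma> / 2"] \<sigma>
      unfolding set_integrable_def by (intro integrable_mult_right) simp
    have "norm (t * f t * exp (- (\<sigma> * t))) \<le> norm (2 / \<sigma> * (f t * exp (- (\<sigma> / 2 * t))))"
      if "t \<ge> 0" for t
    proof -
      have "\<sigma> / 2 * t \<le> exp (\<sigma> / 2 * t)"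
        using exp_ge_add_one_self[of "\<sigma> / 2 * t"] by linarith
      then have "t * exp (- (\<sigma> / 2 * t)) \<le> 2 / \<sigma>"
        using \<sigma> by (simp add: exp_minus field_simps)
      then have "(t * exp (- (\<sigma> / 2 * t))) * (\<bar>f t\<bar> * exp (- (\<sigma> / 2 * t)))
          \<le> 2 / \<sigma> * (\<bar>f t\<bar> * exp (- (\<sigma> / 2 * t)))"
        by (rule mult_right_mono) simp
      moreover have "exp (- (\<sigma> * t)) = exp (- (\<sigma> / 2 * t)) * exp (- (\<sigma> / 2 * t))"
        by (simp flip: exp_add add: field_simps)
      ultimately show ?thesis
        using \<sigma> that by (simp add: abs_mult mult_ac)
    qed
    then show ?thesis
      unfolding set_integrable_def
      by (intro Bochner_Integration.integrable_bound[OF int] AE_I2) (auto simp: indicator_def)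
  qed
  then show ?thesis
    by (simp add: laplace_convergent_def)
qed

text \<open>Mean value estimate on the disc of radius \<open>norm z\<close>; it bounds the
  difference quotients in \<open>DERIV_laplace\<close>.\<close>

lemma norm_exp_minus_one_le:
  fixes z :: complex
  shows "norm (exp z - 1) \<le> norm z * exp (norm z)"
proof -
  have "norm (exp z - exp 0) \<le> exp (norm z) * norm (z - 0)"
  proof (rule field_differentiable_bound[of "cball 0 (norm z)"])
    show "norm (exp w) \<le> exp (norm z)" if "w \<in> cball 0 (norm z)" for w
      using that norm_exp[of w] by (auto intro: order_trans)
  qed (auto intro: DERIV_exp DERIV_subset)
  then show ?thesis by (simp add: mult.commute)
qed

text \<open>Differentiation under the integral sign, by dominated convergence along sequences
  tending to \<open>s\<close>.\<close>

lemma DERIV_laplace: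
  assumes f: "laplace_convergent f" and s: "Re s > 0"
  shows "(laplace f has_field_derivative - laplace (\<lambda>t. t * f t) s) (at s)"
  unfolding has_field_derivative_iff
proof (rule tendsto_at_iff_sequentially[THEN iffD2], intro allI impI)
  note [measurable] = laplace_convergentD(1)[OF f]
  fix X :: "nat \<Rightarrow> complex"
  assume X: "\<forall>i. X i \<in> UNIV - {s}" "X \<longlonglongrightarrow> s"
  \<comment> \<open>Increments of norm below \<open>Re s / 2\<close> cost at most a factor
    \<open>exp (\<sigma> * t)\<close>, so the norm of
    \<open>t * f t * exp (- (\<sigma> * t))\<close> dominates all difference quotients.\<close>
  define \<sigma> where "\<sigma> = Re s / 2"
  have \<sigma>: "\<sigma> > 0" using s by (simp add: \<sigma>_def)
  define E where "E = (\<lambda>z t. complex_of_real (f t) * exp (- (z * complex_of_real t)))"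
  have "\<forall>\<^sub>F n in sequentially. dist (X n) s < \<sigma>"
    using X(2) \<sigma> by (rule tendstoD)
  then obtain N where N: "\<And>n. n \<ge> N \<Longrightarrow> dist (X n) s < \<sigma>"
    by (auto simp: eventually_sequentially)
  \<comment> \<open>Dropping the first \<open>N\<close> terms makes the distance bound hold at every
    index, as the domination requires; \<open>LIMSEQ_offset\<close> restores them at the
    end.\<close>
  define Y where "Y = (\<lambda>n. X (n + N))"
  have Ys: "Y n \<noteq> s" "norm (Y n - s) < \<sigma>" for n
    using X(1) N[of "n + N"] by (auto simp: Y_def dist_norm)
  have Y: "Y \<longlonglongrightarrow> s" unfolding Y_def using X(2) by (rule LIMSEQ_ignore_initial_segment)
  have ReY: "Re (Y n) > 0" for n
    using abs_Re_le_cmod[of "Y n - s"] Ys(2)[of n] s by (auto simp: \<sigma>_def)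
  define D where "D = (\<lambda>n t. indicator {0..} t *\<^sub>R ((E (Y n) t - E s t) / (Y n - s)))"
  have D: "(laplace f (Y n) - laplace f s) / (Y n - s) = (\<integral>t. D n t \<partial>lborel)" for n
  proof -
    have "laplace f (Y n) - laplace f s = (LINT t:{0..}|lborel. E (Y n) t - E s t)"
      unfolding laplace_def E_def
      by (rule set_integral_diff(2)[symmetric]) (intro laplace_integrable f ReY s)+
    then show ?thesis
      by (simp add: set_lebesgue_integral_def D_def scaleR_conv_of_real
          del: integral_divide_zero flip: integral_divide_zero)
  qed
  have "(\<lambda>n. \<integral>t. D n t \<partial>lborel) \<longlonglongrightarrow>
      (\<integral>t. indicator {0..} t *\<^sub>R (- (complex_of_real (t * f t) * exp (- (s * complex_of_real t)))) \<partial>lborel)"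
  proof (rule integral_dominated_convergence)
    show "integrable lborel (\<lambda>t. norm (indicator {0..} t *\<^sub>R (t * f t * exp (- (\<sigma> * t)))))"
      using laplace_convergentD(2)[OF laplace_convergent_times[OF f] \<sigma>]
      unfolding set_integrable_def by (rule integrable_norm)
    show "AE t in lborel. (\<lambda>n. D n t) \<longlonglongrightarrow>
        indicator {0..} t *\<^sub>R (- (complex_of_real (t * f t) * exp (- (s * complex_of_real t))))"
    proof (rule AE_I2)
      fix t :: real
      have "((\<lambda>z. E z t) has_field_derivative
          - (complex_of_real (t * f t) * exp (- (s * complex_of_real t)))) (at s)"
        unfolding E_def by (auto intro!: derivative_eq_intros)
      then have "((\<lambda>z. (E z t - E s t) / (z - s)) \<longlongrightarrow>
          - (complex_of_real (t * f t) * exp (- (s * complex_of_real t)))) (at s)"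
        by (simp add: has_field_derivative_iff)
      moreover have "filterlim Y (at s) sequentially"
        using Y Ys(1) by (simp add: filterlim_at)
      ultimately have "(\<lambda>n. (E (Y n) t - E s t) / (Y n - s)) \<longlonglongrightarrow>
          - (complex_of_real (t * f t) * exp (- (s * complex_of_real t)))"
        by (rule filterlim_compose)
      then show "(\<lambda>n. D n t) \<longlonglongrightarrow>
          indicator {0..} t *\<^sub>R (- (complex_of_real (t * f t) * exp (- (s * complex_of_real t))))"
        unfolding D_def by (rule tendsto_scaleR[OF tendsto_const])
    qed
    show "AE t in lborel. norm (D n t) \<le> norm (indicator {0..} t *\<^sub>R (t * f t * exp (- (\<sigma> * t))))" for n
    proof (rule AE_I2)
      fix t :: real
      show "norm (D n t) \<le> norm (indicator {0..} t *\<^sub>R (t * f t * exp (- (\<sigma> * t))))"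
      proof (cases "t \<ge> 0")
        case True
        define h where "h = Y n - s"
        have h: "h \<noteq> 0" "norm h \<le> \<sigma>" using Ys[of n] by (auto simp: h_def)
        have "exp (- (Y n * t)) = exp (- (s * t)) * exp (- (h * t))"
          by (simp add: h_def algebra_simps flip: exp_add)
        then have "E (Y n) t - E s t = complex_of_real (f t) * exp (- (s * t)) * (exp (- (h * t)) - 1)"
          by (simp add: E_def algebra_simps)
        then have "norm (E (Y n) t - E s t) =
            \<bar>f t\<bar> * exp (- (Re s * t)) * norm (exp (- (h * t)) - 1)"
          by (simp add: norm_mult)
        also have "\<dots> \<le> \<bar>f t\<bar> * exp (- (Re s * t)) * (norm h * t * exp (norm h * t))"
          using norm_exp_minus_one_le[of "- (h * t)"] True
          by (intro mult_left_mono) (auto simp: norm_mult)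
        also have "\<dots> \<le> \<bar>f t\<bar> * exp (- (Re s * t)) * (norm h * t * exp (\<sigma> * t))"
          using h True by (intro mult_left_mono) (auto intro!: mult_right_mono)
        also have "\<dots> = norm h * (t * \<bar>f t\<bar> * (exp (- (Re s * t)) * exp (\<sigma> * t)))"
          by (simp add: mult_ac)
        also have "exp (- (Re s * t)) * exp (\<sigma> * t) = exp (- (\<sigma> * t))"
          by (simp add: \<sigma>_def field_simps flip: exp_add)
        finally show ?thesis
          using h True by (simp add: D_def norm_divide abs_mult field_simps flip: h_def)
      qed (simp add: D_def)
    qed
    show "D n \<in> borel_measurable lborel" for n
      unfolding D_def E_def by measurable
  qed measurable
  also have "(\<integral>t. indicator {0..} t *\<^sub>R
      (- (complex_of_real (t * f t) * exp (- (s * complex_of_real t)))) \<partial>lborel)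
      = - laplace (\<lambda>t. t * f t) s"
    unfolding laplace_def set_lebesgue_integral_def by simp
  finally have "(\<lambda>n. (laplace f (X (n + N)) - laplace f s) / (X (n + N) - s))
      \<longlonglongrightarrow> - laplace (\<lambda>t. t * f t) s"
    by (simp flip: D add: Y_def)
  then show "((\<lambda>y. (laplace f y - laplace f s) / (y - s)) \<circ> X) \<longlonglongrightarrow> - laplace (\<lambda>t. t * f t) s"
    unfolding o_def by (rule LIMSEQ_offset)
qed

lemma holomorphic_laplace:
  assumes "laplace_convergent f"
  shows "laplace f holomorphic_on {s. Re s > 0}"
proof (rule holomorphic_onI)
  fix s assume "s \<in> {s. Re s > 0}"
  then have "(laplace f has_field_derivative - laplace (\<lambda>t. t * f t) s) (at s)"
    by (intro DERIV_laplace assms) simp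
  then show "laplace f field_differentiable at s within {s. Re s > 0}"
    unfolding field_differentiable_def by (blast intro: DERIV_subset)
qed

text \<open>Passage from gauge to Lebesgue integrals: for nonnegative functions integrability is
  absolute, and Borel measurability leads from the completed measure back to
  \<open>lborel\<close>.\<close>

lemma set_integrable_lborel_nonneg:
  fixes f :: "real \<Rightarrow> real"
  assumes [measurable]: "f \<in> borel_measurable borel" "S \<in> sets borel"
    and "\<And>x. x \<in> S \<Longrightarrow> 0 \<le> f x" and "f integrable_on S"
  shows "set_integrable lborel S f"
proof -
  have "f absolutely_integrable_on S"
    using assms by (intro nonnegative_absolutely_integrable_1)
  then show ?thesis
    unfolding set_integrable_def by (subst (asm) integrable_completion) auto
qed

text \<open>Euler's integral for \<open>Gamma (p + 1)\<close> with \<open>\<sigma> * t\<close>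
  substituted for \<open>t\<close>, carried out on the cut-off integrand \<open>?g\<close>.\<close>

lemma
  fixes p \<sigma> :: real
  assumes p: "p > 0" and \<sigma>: "\<sigma> > 0"
  shows set_integrable_powr_exp: "set_integrable lborel {0..} (\<lambda>t. t powr p * exp (- (\<sigma> * t)))"
    and LBINT_powr_exp: "(LINT t:{0..}|lborel. t powr p * exp (- (\<sigma> * t)))
      = Gamma (p + 1) * \<sigma> powr (- (p + 1))"
proof -
  let ?g = "\<lambda>t. indicator {0..} t *\<^sub>R (t powr p * exp (- t)) :: real"
  have hi: "((\<lambda>t. t powr p * exp (- t)) has_integral Gamma (p + 1)) {0..}"
    using Gamma_integral_real[of "p + 1"] p by (simp add: exp_minus divide_inverse)
  have si: "set_integrable lborel {0..} (\<lambda>t. t powr p * exp (- t))"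
    using hi by (intro set_integrable_lborel_nonneg) (auto simp: integrable_on_def)
  have G: "(\<integral>t. ?g t \<partial>lborel) = Gamma (p + 1)"
    using set_borel_integral_eq_integral(2)[OF si] hi
    by (simp add: set_lebesgue_integral_def integral_unique)
  have eq: "?g (0 + \<sigma> * t) = \<sigma> powr p * (indicator {0..} t *\<^sub>R (t powr p * exp (- (\<sigma> * t))))" for t
    using \<sigma> by (auto simp: indicator_def powr_mult zero_le_mult_iff)
  have "integrable lborel (\<lambda>t. ?g (0 + \<sigma> * t))"
    using si \<sigma> unfolding set_integrable_def by (intro lborel_integrable_real_affine) auto
  then show "set_integrable lborel {0..} (\<lambda>t. t powr p * exp (- (\<sigma> * t)))"
    using \<sigma> unfolding eq set_integrable_def by simp
  have "Gamma (p + 1) = \<sigma> * (\<integral>t. ?g (0 + \<sigma> * t) \<partial>lborel)"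
    using lborel_integral_real_affine[of \<sigma> ?g 0] \<sigma> G by simp
  then have "Gamma (p + 1) = \<sigma> * (\<sigma> powr p * (LINT t:{0..}|lborel. t powr p * exp (- (\<sigma> * t))))"
    unfolding eq set_lebesgue_integral_def by simp
  then show "(LINT t:{0..}|lborel. t powr p * exp (- (\<sigma> * t))) = Gamma (p + 1) * \<sigma> powr (- (p + 1))"
    using \<sigma> powr_mult_base[of \<sigma> p] powr_minus[of \<sigma> "p + 1"]
    by (simp add: add.commute divide_inverse flip: mult.assoc)
qed

lemma laplace_convergent_powr: "p > 0 \<Longrightarrow> laplace_convergent (\<lambda>t. t powr p)"
  by (simp add: laplace_convergent_def set_integrable_powr_exp)

text \<open>On the positive real axis this is \<open>LBINT_powr_exp\<close>; the identity theorem
  carries it to the half-plane, where the principal branch is holomorphic.\<close>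

lemma laplace_powr:
  assumes p: "p > 0" and s: "Re s > 0"
  shows "laplace (\<lambda>t. t powr p) s = of_real (Gamma (p + 1)) * s powr (- of_real (p + 1))"
proof -
  let ?d = "\<lambda>s. laplace (\<lambda>t. t powr p) s - of_real (Gamma (p + 1)) * s powr (- of_real (p + 1))"
  have "?d s = 0"
  proof (rule analytic_continuation[where f = ?d and S = "{s. Re s > 0}"
        and U = "complex_of_real ` {0<..}" and \<xi> = 1])
    show "?d holomorphic_on {s. Re s > 0}"
      by (intro holomorphic_intros holomorphic_laplace laplace_convergent_powr p)
         (auto simp: complex_nonpos_Reals_iff)
    show "open {s. Re s > 0}" by (rule open_halfspace_Re_gt)
    show "connected {s. Re s > 0}" by (intro convex_connected convex_halfspace_Re_gt)
    show "complex_of_real ` {0<..} \<subseteq> {s. Re s > 0}" by auto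
    show "(1::complex) islimpt complex_of_real ` {0<..}"
      unfolding islimpt_approachable
    proof (intro allI impI)
      fix e :: real assume "e > 0"
      then have "complex_of_real (1 + e / 2) \<in> complex_of_real ` {0<..}"
        by (intro imageI) simp
      moreover have "complex_of_real (1 + e / 2) \<noteq> 1 \<and> dist (complex_of_real (1 + e / 2)) 1 < e"
        using \<open>e > 0\<close> by (simp add: dist_norm norm_divide)
      ultimately show "\<exists>x'\<in>complex_of_real ` {0<..}. x' \<noteq> 1 \<and> dist x' 1 < e"
        by blast
    qed
    show "?d z = 0" if "z \<in> complex_of_real ` {0<..}" for z
    proof -
      from that obtain \<sigma> where z: "z = complex_of_real \<sigma>" and \<sigma>: "\<sigma> > 0" by auto
      have "laplace (\<lambda>t. t powr p) z =
          (LINT t:{0..}|lborel. complex_of_real (t powr p * exp (- (\<sigma> * t))))"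
        by (simp add: laplace_def z flip: exp_of_real)
      also have "\<dots> = of_real (LINT t:{0..}|lborel. t powr p * exp (- (\<sigma> * t)))"
        by (rule set_integral_complex_of_real)
      also have "\<dots> = of_real (Gamma (p + 1)) * z powr (- of_real (p + 1))"
        using \<sigma> powr_of_real[of \<sigma> "- (p + 1)"] by (simp add: LBINT_powr_exp[OF p \<sigma>] z)
      finally show ?thesis by simp
    qed
    show "(1::complex) \<in> {s. Re s > 0}" "s \<in> {s. Re s > 0}"
      using s by simp_all
  qed
  then show ?thesis by (simp only: right_minus_eq)
qed

section \<open>Local averages and the Laplace transform\<close>

text \<open>A Parseval identity: insert \<open>fejer_fourier\<close> for the kernel and exchange the
  integrals. The inner integral over \<open>t\<close> becomes the transform at
  \<open>Complex \<sigma> (y / h)\<close>.\<close>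

lemma fejer_laplace:
  assumes f: "laplace_convergent f" and \<sigma>: "\<sigma> > 0"
  shows "(LINT t:{0..}|lborel. complex_of_real (f t * exp (- (\<sigma> * t)) * fejer ((x - t) / h)))
    = (LINT y:{-1..1}|lborel. complex_of_real (1 - \<bar>y\<bar>) * exp (\<i> * complex_of_real (y * x / h)) *
        laplace f (Complex \<sigma> (y / h)))"
proof -
  note [measurable] = laplace_convergentD(1)[OF f]
  \<comment> \<open>The cut-offs turn both set integrals into integrals over the line, as Fubini
    expects; the norm of \<open>F t y\<close> then factors into functions of \<open>t\<close> and of
    \<open>y\<close>.\<close>
  define k where "k = (\<lambda>y::real. indicator {-1..1} y *\<^sub>R (1 - \<bar>y\<bar>))"
  define g where "g = (\<lambda>t::real. indicator {0..} t *\<^sub>R (f t * exp (- (\<sigma> * t))))"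
  define F where "F = (\<lambda>t y. complex_of_real (g t) * complex_of_real (k y) *
    exp (\<i> * complex_of_real (y * ((x - t) / h))))"
  have [measurable]: "g \<in> borel_measurable borel" "k \<in> borel_measurable borel"
    unfolding g_def k_def by measurable
  have g: "integrable lborel g"
    using laplace_convergentD(2)[OF f \<sigma>] by (simp add: g_def set_integrable_def)
  have k: "integrable lborel k"
    using borel_integrable_atLeastAtMost'[of "-1" 1 "\<lambda>y::real. 1 - \<bar>y\<bar>"]
    by (simp add: k_def set_integrable_def continuous_intros)
  have norm_F: "norm (F t y) = norm (g t) * norm (k y)" for t y
    by (simp add: F_def norm_mult)
  have meas: "case_prod F \<in> borel_measurable (lborel \<Otimes>\<^sub>M lborel)"
    unfolding F_def by measurable
  have int: "integrable (lborel \<Otimes>\<^sub>M lborel) (case_prod F)"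
  proof (rule lborel_pair.Fubini_integrable[OF meas])
    show "integrable lborel (\<lambda>t. \<integral>y. norm (case_prod F (t, y)) \<partial>lborel)"
      using g by (simp add: norm_F)
    show "AE t in lborel. integrable lborel (\<lambda>y. case_prod F (t, y))"
    proof (rule AE_I2)
      fix t
      show "integrable lborel (\<lambda>y. case_prod F (t, y))"
      proof (rule Bochner_Integration.integrable_bound)
        show "integrable lborel (\<lambda>y. norm (g t) * norm (k y))"
          using k by simp
        show "(\<lambda>y. case_prod F (t, y)) \<in> borel_measurable lborel"
          unfolding F_def by simp
      qed (simp add: norm_F)
    qed
  qed
  have "(LINT t:{0..}|lborel. complex_of_real (f t * exp (- (\<sigma> * t)) * fejer ((x - t) / h)))
      = (\<integral>t. (\<integral>y. F t y \<partial>lborel) \<partial>lborel)"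
  proof -
    have "(\<integral>y. F t y \<partial>lborel) = complex_of_real (g t * fejer ((x - t) / h))" for t
    proof -
      have "(\<integral>y. F t y \<partial>lborel) = complex_of_real (g t) *
          (\<integral>y. complex_of_real (k y) * exp (\<i> * complex_of_real (y * ((x - t) / h))) \<partial>lborel)"
        unfolding F_def mult.assoc by simp
      also have "(\<integral>y. complex_of_real (k y) * exp (\<i> * complex_of_real (y * ((x - t) / h))) \<partial>lborel)
          = complex_of_real (fejer ((x - t) / h))"
        unfolding fejer_fourier[symmetric] set_lebesgue_integral_def k_def
        by (simp add: scaleR_conv_of_real mult.assoc)
      finally show ?thesis by simp
    qed
    then show ?thesis
      by (simp add: set_lebesgue_integral_def g_def scaleR_conv_of_real mult.assoc)
  qed
  also have "\<dots> = (\<integral>y. (\<integral>t. F t y \<partial>lborel) \<partial>lborel)"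
    using lborel_pair.Fubini_integral[OF int] by simp
  also have "\<dots> = (LINT y:{-1..1}|lborel. complex_of_real (1 - \<bar>y\<bar>) *
      exp (\<i> * complex_of_real (y * x / h)) * laplace f (Complex \<sigma> (y / h)))"
  proof -
    have "(\<integral>t. F t y \<partial>lborel) = complex_of_real (k y) * exp (\<i> * complex_of_real (y * x / h)) *
        laplace f (Complex \<sigma> (y / h))" for y
    proof -
      have "F t y = complex_of_real (k y) * exp (\<i> * complex_of_real (y * x / h)) *
          (indicator {0..} t *\<^sub>R (complex_of_real (f t) * exp (- (Complex \<sigma> (y / h) * complex_of_real t))))" for t
      proof -
        have "exp (\<i> * complex_of_real (y * ((x - t) / h))) * exp (- complex_of_real (\<sigma> * t))
            = exp (\<i> * complex_of_real (y * x / h)) * exp (- (Complex \<sigma> (y / h) * complex_of_real t))"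
          by (simp add: Complex_eq algebra_simps diff_divide_distrib flip: exp_add)
        then show ?thesis
          by (simp add: F_def g_def scaleR_conv_of_real mult_ac flip: exp_of_real)
      qed
      then show ?thesis
        unfolding laplace_def set_lebesgue_integral_def by (simp only: integral_mult_right_zero)
    qed
    then show ?thesis
      by (simp add: set_lebesgue_integral_def k_def scaleR_conv_of_real mult.assoc)
  qed
  finally show ?thesis .
qed

text \<open>Raise \<open>v / p \<le> exp (v / p)\<close> to the power \<open>p\<close>. The bound
  supplies dominating constants below.\<close>

lemma powr_mult_exp_le:
  fixes v p :: real
  assumes "v \<ge> 0" "p > 0"
  shows "v powr p * exp (- v) \<le> p powr p"
proof -
  have "v / p \<le> exp (v / p)"
    using exp_ge_add_one_self[of "v / p"] by linarith
  then have "(v / p) powr p \<le> exp (v / p) powr p"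
    using assms by (intro powr_mono2) auto
  also have "\<dots> = exp v"
    using assms by (simp add: powr_def)
  finally have "v powr p \<le> exp v * p powr p"
    using assms by (simp add: powr_divide field_simps)
  then show ?thesis
    by (simp add: exp_minus field_simps)
qed

section \<open>Local averages of pure powers\<close>

lemma LBINT_fejer_affine:
  fixes g :: "real \<Rightarrow> real"
  assumes "h > 0"
  shows "(\<integral>t. g t * fejer ((x - t) / h) \<partial>lborel) = h * (\<integral>u. g (x - h * u) * fejer u \<partial>lborel)"
  using lborel_integral_real_affine[of "- h" "\<lambda>t. g t * fejer ((x - t) / h)" x] assms
  by simp

text \<open>With \<open>t = x - h * u\<close> the normalised integrand is a bounded function of
  \<open>t / x = 1 - h * u / x\<close>, which tends to 1. The factor \<open>exp (- 1)\<close> is the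
  damping at \<open>t = x\<close>.\<close>

lemma powr_fejer_tendsto:
  assumes p: "p > 0" and h: "h > 0"
  shows "((\<lambda>x. x powr (- p) * (LINT t:{0..}|lborel. t powr p * exp (- (1 / x * t)) * fejer ((x - t) / h)))
    \<longlongrightarrow> exp (- 1) * h * (\<integral>u. fejer u \<partial>lborel)) at_top"
proof -
  define G where "G = (\<lambda>v::real. indicator {0..} v * (v powr p * exp (- v)))"
  have [measurable]: "G \<in> borel_measurable borel"
    unfolding G_def by measurable
  have G_bd: "0 \<le> G v \<and> G v \<le> p powr p" for v
    using powr_mult_exp_le[OF _ p, of v] by (auto simp: G_def indicator_def)
  have "((\<lambda>x. \<integral>u. G (1 - h * u / x) * fejer u \<partial>lborel) \<longlongrightarrow> (\<integral>u. exp (- 1) * fejer u \<partial>lborel)) at_top"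
  proof (rule integral_dominated_convergence_at_top)
    show "integrable lborel (\<lambda>u. p powr p * fejer u)"
      using integrable_fejer by simp
    show "AE u in lborel. ((\<lambda>x. G (1 - h * u / x) * fejer u) \<longlongrightarrow> exp (- 1) * fejer u) at_top"
    proof (intro AE_I2 tendsto_mult tendsto_const)
      fix u
      have lim: "((\<lambda>x. 1 - h * u / x) \<longlongrightarrow> 1) at_top"
        by real_asymp
      have "((\<lambda>x. (1 - h * u / x) powr p * exp (- (1 - h * u / x))) \<longlongrightarrow> 1 powr p * exp (- 1)) at_top"
        by (intro tendsto_intros lim) auto
      moreover have "\<forall>\<^sub>F x in at_top. 1 - h * u / x > 0"
        using order_tendstoD(1)[OF lim, of 0] by simp
      then have "\<forall>\<^sub>F x in at_top. (1 - h * u / x) powr p * exp (- (1 - h * u / x)) = G (1 - h * u / x)"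
        by eventually_elim (simp add: G_def)
      ultimately show "((\<lambda>x. G (1 - h * u / x)) \<longlongrightarrow> exp (- 1)) at_top"
        by (auto intro: Lim_transform_eventually)
    qed
    show "\<forall>\<^sub>F x in at_top. AE u in lborel. norm (G (1 - h * u / x) * fejer u) \<le> p powr p * fejer u"
      using G_bd fejer_nonneg
      by (intro always_eventually allI AE_I2) (simp add: abs_mult mult_right_mono)
  qed measurable
  then have "((\<lambda>x. h * (\<integral>u. G (1 - h * u / x) * fejer u \<partial>lborel))
      \<longlongrightarrow> h * (\<integral>u. exp (- 1) * fejer u \<partial>lborel)) at_top"
    by (rule tendsto_mult_left)
  moreover have "\<forall>\<^sub>F x in at_top. h * (\<integral>u. G (1 - h * u / x) * fejer u \<partial>lborel) =
      x powr (- p) * (LINT t:{0..}|lborel. t powr p * exp (- (1 / x * t)) * fejer ((x - t) / h))"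
    using eventually_gt_at_top[of 0]
  proof eventually_elim
    case (elim x)
    have "x powr (- p) * (LINT t:{0..}|lborel. t powr p * exp (- (1 / x * t)) * fejer ((x - t) / h))
        = (\<integral>t. x powr (- p) * (indicator {0..} t * (t powr p * exp (- (1 / x * t)))) * fejer ((x - t) / h) \<partial>lborel)"
      by (simp add: set_lebesgue_integral_def mult.assoc)
    also have "\<dots> = (\<integral>t. G (t / x) * fejer ((x - t) / h) \<partial>lborel)"
    proof -
      have "x powr (- p) * (indicator {0..} t * (t powr p * exp (- (1 / x * t)))) = G (t / x)" for t
        using elim by (auto simp: G_def indicator_def powr_divide powr_minus field_simps)
      then show ?thesis by simp
    qed
    also have "\<dots> = h * (\<integral>u. G ((x - h * u) / x) * fejer u \<partial>lborel)"
      using h by (rule LBINT_fejer_affine)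
    also have "\<dots> = h * (\<integral>u. G (1 - h * u / x) * fejer u \<partial>lborel)"
      using elim by (simp add: diff_divide_distrib)
    finally show ?case by simp
  qed
  ultimately show ?thesis
    by (rule Lim_transform_eventually[THEN tendsto_eq_rhs]) simp
qed

section \<open>Comparison of averages through their transforms\<close>

lemma laplace_measurable [measurable]:
  assumes "laplace_convergent f"
  shows "laplace f \<in> borel_measurable borel"
proof -
  note [measurable] = laplace_convergentD(1)[OF assms]
  show ?thesis
    unfolding laplace_def[abs_def] set_lebesgue_integral_def by measurable
qed

lemma Complex_measurable [measurable]: "(\<lambda>y. Complex a (y / b)) \<in> borel_measurable borel"
  by (simp add: Complex_eq)

lemma set_integrable_fourier_laplace:
  assumes f: "laplace_convergent f" and \<sigma>: "\<sigma> > 0"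
  shows "set_integrable lborel {-1..1} (\<lambda>y. complex_of_real (1 - \<bar>y\<bar>) *
    exp (\<i> * complex_of_real (y * x / h)) * laplace f (Complex \<sigma> (y / h)))"
proof (rule borel_integrable_atLeastAtMost')
  have "continuous_on {-1..1} (\<lambda>y. laplace f (Complex \<sigma> (y / h)))"
    by (rule continuous_on_compose2[OF holomorphic_on_imp_continuous_on[OF holomorphic_laplace[OF f]]])
       (use \<sigma> in \<open>auto simp: Complex_eq divide_inverse intro!: continuous_intros\<close>)
  then show "continuous_on {-1..1} (\<lambda>y. complex_of_real (1 - \<bar>y\<bar>) *
      exp (\<i> * complex_of_real (y * x / h)) * laplace f (Complex \<sigma> (y / h)))"
    unfolding divide_inverse by (intro continuous_intros)
qed

text \<open>The abscissa \<open>1 / x\<close> turns both averages into integrals of transforms over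
  one segment. There \<open>norm s\<close> is at least \<open>1 / x\<close> and at least
  \<open>\<bar>y / h\<bar>\<close>: after multiplication by \<open>x powr (- p)\<close> the first
  bound dominates the difference, the second makes it tend to 0.\<close>

lemma laplace_fejer_tendsto:
  assumes f: "laplace_convergent f" and p: "p > 0" and h: "h > 0" and \<sigma>0: "\<sigma>0 > 0"
    and bd: "\<And>s. 0 < Re s \<Longrightarrow> Re s < \<sigma>0 \<Longrightarrow> \<bar>Im s\<bar> \<le> 1 / h \<Longrightarrow>
      norm (laplace f s - c * laplace (\<lambda>t. t powr p) s) \<le> B * (norm s powr (- p) + 1)"
  shows "((\<lambda>x. complex_of_real
      (x powr (- p) * (LINT t:{0..}|lborel. f t * exp (- (1 / x * t)) * fejer ((x - t) / h))))
    \<longlongrightarrow> c * complex_of_real (exp (- 1) * h * (\<integral>u. fejer u \<partial>lborel))) at_top"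
proof -
  note g = laplace_convergent_powr[OF p]
  note [measurable] = laplace_measurable[OF f] laplace_measurable[OF g]
  define R where "R = (\<lambda>s. laplace f s - c * laplace (\<lambda>t. t powr p) s)"
  \<comment> \<open>Normalised integrand for the difference \<open>R\<close> of the transforms. Its
    integral must tend to 0, since \<open>powr_fejer_tendsto\<close> settles the comparison
    term.\<close>
  define S where "S = (\<lambda>x y. complex_of_real (x powr (- p)) * (indicator {-1..1} y *\<^sub>R
    (complex_of_real (1 - \<bar>y\<bar>) * exp (\<i> * complex_of_real (y * x / h)) * R (Complex (1 / x) (y / h)))))"
  have norm_S: "norm (S x y) \<le> indicator {-1..1} y * (x powr (- p) * norm (R (Complex (1 / x) (y / h))))" for x y
  proof (cases "y \<in> {-1..1}")
    case True
    then have "norm (complex_of_real (1 - \<bar>y\<bar>)) \<le> 1"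
      unfolding norm_of_real by auto
    then have "norm (complex_of_real (1 - \<bar>y\<bar>)) * norm (R (Complex (1 / x) (y / h)))
        \<le> norm (R (Complex (1 / x) (y / h)))"
      by (intro mult_left_le_one_le) auto
    then show ?thesis
      using True by (simp add: S_def norm_mult mult_left_mono del: of_real_diff)
  qed (simp add: S_def)
  have R_bd: "norm (R (Complex (1 / x) (y / h))) \<le> B * (norm (Complex (1 / x) (y / h)) powr (- p) + 1)"
    if "x > 0" "x > 1 / \<sigma>0" "y \<in> {-1..1}" for x y
    unfolding R_def using that h \<sigma>0 by (intro bd) (auto simp: field_simps abs_le_iff)
  \<comment> \<open>At the point \<open>\<sigma>0 / 2\<close> the assumption bounds a norm by
    \<open>B\<close> times a positive number.\<close>
  have B: "B \<ge> 0"
  proof -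
    have "0 \<le> B * (norm (complex_of_real (\<sigma>0 / 2)) powr (- p) + 1)"
      using bd[of "complex_of_real (\<sigma>0 / 2)"] \<sigma>0 h by (auto intro: order_trans[OF norm_ge_zero])
    moreover have "norm (complex_of_real (\<sigma>0 / 2)) powr (- p) + 1 > 0"
      by (simp add: add_nonneg_pos)
    ultimately show ?thesis by (simp add: zero_le_mult_iff)
  qed
  have "((\<lambda>x. \<integral>y. S x y \<partial>lborel) \<longlongrightarrow> (\<integral>y. 0 \<partial>(lborel :: real measure))) at_top"
  proof (rule integral_dominated_convergence_at_top)
    show "integrable lborel (\<lambda>y::real. indicator {-1..1} y * (2 * B))"
      by simp
    show "AE y in lborel. ((\<lambda>x. S x y) \<longlongrightarrow> 0) at_top"
      \<comment> \<open>At \<open>y = 0\<close> only the bound \<open>norm s \<ge> 1 / x\<close> is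
        left, which yields boundedness but no decay; this null set is removed.\<close>
      using AE_lborel_singleton[of 0]
    proof eventually_elim
      case (elim y)
      show ?case
      proof (rule Lim_null_comparison)
        show "\<forall>\<^sub>F x in at_top. norm (S x y) \<le> x powr (- p) * (B * (\<bar>y / h\<bar> powr (- p) + 1))"
          using eventually_gt_at_top[of 0] eventually_gt_at_top[of "1 / \<sigma>0"]
        proof eventually_elim
          case (elim x)
          show ?case
          proof (cases "y \<in> {-1..1}")
            case True
            have "norm (Complex (1 / x) (y / h)) powr (- p) \<le> \<bar>y / h\<bar> powr (- p)"
              using abs_Im_le_cmod[of "Complex (1 / x) (y / h)"] \<open>y \<noteq> 0\<close> h p
              by (intro powr_mono2') auto
            then have "norm (R (Complex (1 / x) (y / h))) \<le> B * (\<bar>y / h\<bar> powr (- p) + 1)"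
              using B by (intro order_trans[OF R_bd[OF elim True]] mult_left_mono add_right_mono)
            then have "x powr (- p) * norm (R (Complex (1 / x) (y / h)))
                \<le> x powr (- p) * (B * (\<bar>y / h\<bar> powr (- p) + 1))"
              by (rule mult_left_mono) simp
            then show ?thesis using norm_S[of x y] True by simp
          qed (use B norm_S[of x y] in \<open>simp add: S_def\<close>)
        qed
        have "((\<lambda>x. x powr (- p)) \<longlongrightarrow> 0) at_top"
          using p by (intro tendsto_neg_powr filterlim_ident) auto
        then show "((\<lambda>x. x powr (- p) * (B * (\<bar>y / h\<bar> powr (- p) + 1))) \<longlongrightarrow> 0) at_top"
          by (rule tendsto_mult_left_zero)
      qed
    qed
    show "\<forall>\<^sub>F x in at_top. AE y in lborel. norm (S x y) \<le> indicator {-1..1} y * (2 * B)"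
      using eventually_gt_at_top[of "1 / \<sigma>0"] eventually_ge_at_top[of 1]
    proof eventually_elim
      case (elim x)
      show ?case
      proof (rule AE_I2)
        fix y :: real
        show "norm (S x y) \<le> indicator {-1..1} y * (2 * B)"
        proof (cases "y \<in> {-1..1}")
          case True
          have "norm (Complex (1 / x) (y / h)) powr (- p) \<le> (1 / x) powr (- p)"
            using abs_Re_le_cmod[of "Complex (1 / x) (y / h)"] elim p
            by (intro powr_mono2') auto
          also have "\<dots> = x powr p"
            using elim by (simp add: powr_divide powr_minus)
          finally have "norm (R (Complex (1 / x) (y / h))) \<le> B * (x powr p + 1)"
            using B elim(2)
            by (intro order_trans[OF R_bd[OF _ elim(1) True]] mult_left_mono add_right_mono) auto
          also have "\<dots> \<le> B * (2 * x powr p)"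
            using elim p B ge_one_powr_ge_zero[of x p] by (intro mult_left_mono) auto
          finally have "x powr (- p) * norm (R (Complex (1 / x) (y / h))) \<le> x powr (- p) * (B * (2 * x powr p))"
            by (rule mult_left_mono) simp
          also have "\<dots> = 2 * B"
            using elim by (simp add: powr_minus)
          finally show ?thesis using norm_S[of x y] True by simp
        qed (use norm_S[of x y] in \<open>simp add: S_def\<close>)
      qed
    qed
    show "S x \<in> borel_measurable lborel" for x
      unfolding S_def R_def by measurable
  qed measurable
  then have "((\<lambda>x. (\<integral>y. S x y \<partial>lborel) + c * complex_of_real
      (x powr (- p) * (LINT t:{0..}|lborel. t powr p * exp (- (1 / x * t)) * fejer ((x - t) / h))))
    \<longlongrightarrow> 0 + c * complex_of_real (exp (- 1) * h * (\<integral>u. fejer u \<partial>lborel))) at_top"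
    by (intro tendsto_add tendsto_mult tendsto_of_real tendsto_const powr_fejer_tendsto p h) simp
  moreover have "\<forall>\<^sub>F x in at_top. (\<integral>y. S x y \<partial>lborel) + c * complex_of_real
      (x powr (- p) * (LINT t:{0..}|lborel. t powr p * exp (- (1 / x * t)) * fejer ((x - t) / h)))
    = complex_of_real (x powr (- p) * (LINT t:{0..}|lborel. f t * exp (- (1 / x * t)) * fejer ((x - t) / h)))"
    using eventually_gt_at_top[of 0]
  proof eventually_elim
    case (elim x)
    let ?e = "\<lambda>y. complex_of_real (1 - \<bar>y\<bar>) * exp (\<i> * complex_of_real (y * x / h))"
    let ?z = "\<lambda>y. Complex (1 / x) (y / h)"
    have x: "1 / x > 0" using elim by simp
    have "(\<integral>y. S x y \<partial>lborel) = complex_of_real (x powr (- p)) *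
        (LINT y:{-1..1}|lborel. ?e y * R (?z y))"
      unfolding S_def set_lebesgue_integral_def by (rule integral_mult_right_zero)
    also have "(LINT y:{-1..1}|lborel. ?e y * R (?z y)) =
        (LINT y:{-1..1}|lborel. ?e y * laplace f (?z y) - c * (?e y * laplace (\<lambda>t. t powr p) (?z y)))"
      by (simp add: R_def algebra_simps)
    also have "\<dots> = (LINT y:{-1..1}|lborel. ?e y * laplace f (?z y)) -
        c * (LINT y:{-1..1}|lborel. ?e y * laplace (\<lambda>t. t powr p) (?z y))"
      using set_integrable_fourier_laplace[OF f x] set_integrable_fourier_laplace[OF g x]
      by (subst set_integral_diff(2)) (auto simp: set_integral_mult_right)
    also have "(LINT y:{-1..1}|lborel. ?e y * laplace f (?z y)) =
        of_real (LINT t:{0..}|lborel. f t * exp (- (1 / x * t)) * fejer ((x - t) / h))"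
      using fejer_laplace[OF f x] by (simp only: set_integral_complex_of_real)
    also have "(LINT y:{-1..1}|lborel. ?e y * laplace (\<lambda>t. t powr p) (?z y)) =
        of_real (LINT t:{0..}|lborel. t powr p * exp (- (1 / x * t)) * fejer ((x - t) / h))"
      using fejer_laplace[OF g x] by (simp only: set_integral_complex_of_real)
    finally show ?case
      by (simp add: algebra_simps)
  qed
  ultimately show ?thesis
    by (rule Lim_transform_eventually[THEN tendsto_eq_rhs]) simp
qed

section \<open>The Tauberian argument\<close>

text \<open>
  Both bounds compare \<open>a x\<close> with the average centred at \<open>x + \<epsilon>\<close> with kernel width \<open>h = \<epsilon> / T\<close>: up to mass
  \<open>\<epsilon>\<close>, the kernel then lives on \<open>[x, x + 2 \<epsilon>]\<close>, where \<open>growth\<close> applies with base point \<open>x\<close>.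
\<close>

lemma fejer_tauberian:
  fixes a :: "real \<Rightarrow> real"
  defines "W \<equiv> \<integral>u. fejer u \<partial>lborel"
  assumes conv: "laplace_convergent a"
    and nonneg: "\<And>t. t \<ge> 0 \<Longrightarrow> a t \<ge> 0"
    and bdd: "\<And>T. \<exists>D. \<forall>t\<in>{0..T}. a t \<le> D"
    and \<kappa>: "\<kappa> > 0"
    and growth: "\<And>s t. 1 \<le> s \<Longrightarrow> s \<le> t \<Longrightarrow>
      exp (- (\<kappa> * (t - s))) * a s \<le> a t \<and> a t \<le> exp (\<kappa> * (t - s)) * a s"
    and p: "p > 0"
    and lim: "\<And>h. h > 0 \<Longrightarrow>
      ((\<lambda>x. x powr (- p) * (LINT t:{0..}|lborel. a t * exp (- (1 / x * t)) * fejer ((x - t) / h)))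
        \<longlongrightarrow> C * (exp (- 1) * h * W)) at_top"
  shows "((\<lambda>t. a t * t powr (- p)) \<longlongrightarrow> C) at_top"
proof -
  note [measurable] = laplace_convergentD(1)[OF conv]
  have W: "W > 0" unfolding W_def by (rule fejer_integral_pos)
  define V where "V = (\<lambda>T. \<integral>u. indicator {-T..T} u * fejer u \<partial>lborel)"
  \<comment> \<open>The damped and normalised integrand: with \<open>t = X - h * u\<close>, the
    average centred at \<open>X\<close> is \<open>h\<close> times the integral of
    \<open>G X (X - h * u) * fejer u\<close>.\<close>
  define G where "G = (\<lambda>X t. X powr (- p) * (indicator {0..} t * (a t * exp (- (1 / X * t)))))"
  have int_V: "integrable lborel (\<lambda>u. indicator {-T..T} u * fejer u)" for T
    by (rule Bochner_Integration.integrable_bound[OF integrable_fejer])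
       (auto simp: indicator_def)
  have V_le: "V T \<le> W" for T
    unfolding V_def W_def
    by (intro integral_mono int_V integrable_fejer) (auto simp: indicator_def fejer_nonneg)
  have int_G: "integrable lborel (\<lambda>u. G X (X - h * u) * fejer u)" if "X > 0" "h > 0" for X h
  proof (rule Bochner_Integration.integrable_bound)
    have "integrable lborel (G X)"
      unfolding G_def using laplace_convergentD(2)[OF conv, of "1 / X"] that
      by (simp add: set_integrable_def)
    from lborel_integrable_real_affine[OF this, of "- h" X]
    show "integrable lborel (\<lambda>u. 2 * G X (X - h * u))"
      using that by simp
    show "AE u in lborel. norm (G X (X - h * u) * fejer u) \<le> norm (2 * G X (X - h * u))"
      using fejer_le_2 fejer_nonneg
      by (intro AE_I2) (simp add: abs_mult mult.commute mult_right_mono)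
  qed (simp add: G_def)
  have G_nonneg: "G X t \<ge> 0" for X t
    using nonneg by (simp add: G_def indicator_def)
  \<comment> \<open>The assumed limit with the factor \<open>h\<close> divided out and the centre
    moved to \<open>x + \<epsilon>\<close>.\<close>
  have M: "((\<lambda>x. (\<integral>u. G (x + \<epsilon>) (x + \<epsilon> - h * u) * fejer u \<partial>lborel)) \<longlongrightarrow> C * (exp (- 1) * W)) at_top"
    if h: "h > 0" for h \<epsilon>
  proof -
    have "X powr (- p) * (LINT t:{0..}|lborel. a t * exp (- (1 / X * t)) * fejer ((X - t) / h))
        = h * (\<integral>u. G X (X - h * u) * fejer u \<partial>lborel)" for X
      unfolding LBINT_fejer_affine[OF h, symmetric]
      by (simp add: G_def set_lebesgue_integral_def mult.assoc)
    then have "((\<lambda>X. h * (\<integral>u. G X (X - h * u) * fejer u \<partial>lborel)) \<longlongrightarrow> C * (exp (- 1) * h * W)) at_top"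
      using lim[OF h] by simp
    from tendsto_mult_left[OF this, of "1 / h"]
    have "((\<lambda>X. \<integral>u. G X (X - h * u) * fejer u \<partial>lborel) \<longlongrightarrow> C * (exp (- 1) * W)) at_top"
      using h by (simp add: mult_ac)
    moreover have "filterlim (\<lambda>x. x + \<epsilon>) at_top at_top"
      by real_asymp
    ultimately show ?thesis
      by (rule filterlim_compose)
  qed
  have choose_T: "\<exists>T>0. V T \<ge> (1 - \<epsilon>) * W" if "\<epsilon> > 0" for \<epsilon>
  proof -
    have "(V \<longlongrightarrow> W) at_top"
      unfolding V_def W_def by (rule fejer_truncated_tendsto)
    then have "\<forall>\<^sub>F T in at_top. (1 - \<epsilon>) * W < V T"
      by (rule order_tendstoD) (use that W in \<open>simp add: algebra_simps\<close>)
    with eventually_gt_at_top[of 0] have "\<forall>\<^sub>F T in at_top. T > 0 \<and> (1 - \<epsilon>) * W < V T"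
      by eventually_elim simp
    then obtain T where "T > 0" "(1 - \<epsilon>) * W < V T"
      by (auto simp: eventually_at_top_linorder)
    then show ?thesis by (intro exI[of _ T]) simp
  qed
  define f where "f = (\<lambda>t. a t * t powr (- p))"
  \<comment> \<open>The losses in the upper bound: \<open>(1 + \<epsilon>) powr p\<close> from
    replacing \<open>X\<close> by \<open>x\<close>, \<open>exp (2 * \<kappa> * \<epsilon>)\<close>
    from \<open>growth\<close> over a length up to \<open>2 * \<epsilon>\<close>,
    \<open>exp \<epsilon>\<close> from the damping, and \<open>1 - \<epsilon>\<close> from the mass
    outside the window.\<close>
  define U where "U = (\<lambda>\<epsilon>. (1 + \<epsilon>) powr p * exp ((2 * \<kappa> + 1) * \<epsilon>) / (1 - \<epsilon>) * (C + \<epsilon>))"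
  have upper: "\<forall>\<^sub>F x in at_top. f x \<le> U \<epsilon>" if \<epsilon>: "0 < \<epsilon>" "\<epsilon> < 1" for \<epsilon>
  proof -
    obtain T where T: "T > 0" "V T \<ge> (1 - \<epsilon>) * W" using choose_T \<epsilon> by blast
    define h where "h = \<epsilon> / T"
    have h: "h > 0" "h * T = \<epsilon>" using T \<epsilon> by (auto simp: h_def)
    have "\<forall>\<^sub>F x in at_top. (\<integral>u. G (x + \<epsilon>) (x + \<epsilon> - h * u) * fejer u \<partial>lborel) < (C + \<epsilon>) * (exp (- 1) * W)"
      using M[OF h(1), of \<epsilon>] by (rule order_tendstoD) (use \<epsilon> W in \<open>simp add: algebra_simps\<close>)
    then show ?thesis
      using eventually_ge_at_top[of 1]
    proof eventually_elim
      case (elim x)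
      define X where "X = x + \<epsilon>"
      have X: "X \<ge> 1" "X > 0" using elim \<epsilon> by (auto simp: X_def)
      \<comment> \<open>Lower bound for the integrand on the window, where
        \<open>t \<le> X * (1 + \<epsilon>)\<close> keeps the damping at least
        \<open>exp (- 1 - \<epsilon>)\<close>.\<close>
      define A where "A = X powr (- p) * (exp (- (2 * \<kappa> * \<epsilon>)) * a x * exp (- 1 - \<epsilon>))"
      have "G X (X - h * u) \<ge> A * indicator {-T..T} u" for u
      proof (cases "u \<in> {-T..T}")
        case True
        have "h * \<bar>u\<bar> \<le> h * T"
          using True h by (intro mult_left_mono) auto
        then have "\<bar>h * u\<bar> \<le> \<epsilon>"
          using h by (simp add: abs_mult)
        then have t: "x \<le> X - h * u" "X - h * u \<le> x + 2 * \<epsilon>"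
          unfolding X_def by linarith+
        have "exp (- (2 * \<kappa> * \<epsilon>)) * a x \<le> exp (- (\<kappa> * (X - h * u - x))) * a x"
          using \<kappa> t nonneg[of x] elim by (intro mult_right_mono) auto
        also have "\<dots> \<le> a (X - h * u)"
          using growth[of x "X - h * u"] elim t by simp
        finally have 1: "exp (- (2 * \<kappa> * \<epsilon>)) * a x \<le> a (X - h * u)" .
        have "\<epsilon> \<le> \<epsilon> * X"
          using X \<epsilon> by simp
        then have "X - h * u \<le> X + \<epsilon> * X"
          using t X_def by linarith
        then have 2: "exp (- 1 - \<epsilon>) \<le> exp (- (1 / X * (X - h * u)))"
          using X by (simp add: field_simps)
        show ?thesis
          using True t elim(2) mult_mono[OF 1 2] nonneg[of x] nonneg[of "X - h * u"]
          by (simp add: A_def G_def mult_left_mono)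
      qed (simp add: G_nonneg)
      then have "(\<integral>u. A * (indicator {-T..T} u * fejer u) \<partial>lborel)
          \<le> (\<integral>u. G X (X - h * u) * fejer u \<partial>lborel)"
        using fejer_nonneg
        by (intro integral_mono integrable_mult_right int_V int_G X h)
           (auto simp flip: mult.assoc intro!: mult_right_mono)
      then have "A * V T < (C + \<epsilon>) * (exp (- 1) * W)"
        using elim(1) by (simp add: V_def X_def)
      moreover have "A * ((1 - \<epsilon>) * W) \<le> A * V T"
        using T nonneg[of x] elim by (intro mult_left_mono) (auto simp: A_def)
      ultimately have "A * (1 - \<epsilon>) * W < (C + \<epsilon>) * exp (- 1) * W"
        by (simp add: mult.assoc)
      then have *: "A * (1 - \<epsilon>) \<le> (C + \<epsilon>) * exp (- 1)"
        using W by simp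
      \<comment> \<open>From \<open>x \<ge> 1\<close> follows
        \<open>x + \<epsilon> \<le> x * (1 + \<epsilon>)\<close>.\<close>
      have "X powr p \<le> (x * (1 + \<epsilon>)) powr p"
        using elim \<epsilon> p X mult_left_mono[of 1 x \<epsilon>]
        by (intro powr_mono2) (auto simp: X_def algebra_simps)
      also have "\<dots> = x powr p * (1 + \<epsilon>) powr p"
        using elim \<epsilon> by (simp add: powr_mult)
      finally have "x powr (- p) \<le> (1 + \<epsilon>) powr p * X powr (- p)"
        using elim(2) X by (simp add: powr_minus field_simps)
      then have "a x * x powr (- p) \<le> a x * ((1 + \<epsilon>) powr p * X powr (- p))"
        using nonneg[of x] elim by (intro mult_left_mono) auto
      also have "\<dots> = (1 + \<epsilon>) powr p * exp ((2 * \<kappa> + 1) * \<epsilon>) * (A * exp 1)"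
        by (simp add: A_def flip: exp_add add: algebra_simps)
      also have "A * exp 1 \<le> (C + \<epsilon>) / (1 - \<epsilon>)"
        using * \<epsilon> by (simp add: exp_minus field_simps)
      finally show ?case
        by (simp add: f_def U_def mult_left_mono)
    qed
  qed
  \<comment> \<open>The lower bound needs control of the kernel tails, which the upper bound provides.\<close>
  obtain K D where KD: "K \<ge> 0" "D \<ge> 0" "\<And>t. t \<ge> 0 \<Longrightarrow> a t \<le> K * t powr p + D"
  proof -
    from upper[of "1/2"] obtain x0 where x0: "\<And>x. x \<ge> x0 \<Longrightarrow> f x \<le> U (1/2)"
      by (auto simp: eventually_at_top_linorder)
    obtain D where D: "\<And>t. t \<in> {0..max 1 x0} \<Longrightarrow> a t \<le> D"
      using bdd[of "max 1 x0"] by blast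
    have D0: "D \<ge> 0" using order_trans[OF nonneg[of 0] D[of 0]] by simp
    \<comment> \<open>For large \<open>t\<close> this is \<open>upper\<close> at \<open>1/2\<close>,
      on the initial segment it is \<open>bdd\<close>; \<open>max 0\<close> gives a nonnegative
      coefficient whatever the sign of \<open>U (1/2)\<close>.\<close>
    have "a t \<le> max 0 (U (1/2)) * t powr p + D" if t: "t \<ge> 0" for t
    proof (cases "t \<le> max 1 x0")
      case True
      then show ?thesis
        using D[of t] t by (intro add_increasing mult_nonneg_nonneg) auto
    next
      case False
      then have "f t \<le> max 0 (U (1/2))" using x0[of t] by (auto simp: le_max_iff_disj)
      then have "a t \<le> max 0 (U (1/2)) * t powr p"
        using False by (simp add: f_def powr_minus field_simps)
      then show ?thesis using D0 by simp
    qed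
    with D0 show ?thesis by (intro that[of "max 0 (U (1/2))" D]) auto
  qed
  \<comment> \<open>Uniform bound for \<open>G X\<close> when \<open>X \<ge> 1\<close>, by
    \<open>powr_mult_exp_le\<close>. Times the mass outside the window, at most
    \<open>\<epsilon> * W\<close>, it controls the tails.\<close>
  define Q where "Q = K * p powr p + D"
  define L where "L = (\<lambda>\<epsilon>. (C - \<epsilon> - Q * exp 1 * \<epsilon>) * exp (- ((2 * \<kappa> + 1) * \<epsilon>)))"
  have Q: "Q \<ge> 0" using KD by (simp add: Q_def)
  have lower: "\<forall>\<^sub>F x in at_top. L \<epsilon> \<le> f x" if \<epsilon>: "0 < \<epsilon>" "\<epsilon> < 1" for \<epsilon>
  proof -
    obtain T where T: "T > 0" "V T \<ge> (1 - \<epsilon>) * W" using choose_T \<epsilon> by blast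
    define h where "h = \<epsilon> / T"
    have h: "h > 0" "h * T = \<epsilon>" using T \<epsilon> by (auto simp: h_def)
    have "\<forall>\<^sub>F x in at_top. (C - \<epsilon>) * (exp (- 1) * W) < (\<integral>u. G (x + \<epsilon>) (x + \<epsilon> - h * u) * fejer u \<partial>lborel)"
      using M[OF h(1), of \<epsilon>] by (rule order_tendstoD) (use \<epsilon> W in \<open>simp add: algebra_simps\<close>)
    then show ?thesis
      using eventually_ge_at_top[of 1]
    proof eventually_elim
      case (elim x)
      define X where "X = x + \<epsilon>"
      have X: "X \<ge> 1" "X > 0" using elim \<epsilon> by (auto simp: X_def)
      \<comment> \<open>Upper bound for the integrand on the window: \<open>x \<le> X\<close> allows
        \<open>x powr (- p)\<close> for the power, and \<open>t \<ge> X - \<epsilon> * X\<close>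
        caps the damping at \<open>exp (\<epsilon> - 1)\<close>.\<close>
      define A where "A = exp (2 * \<kappa> * \<epsilon>) * f x * exp (\<epsilon> - 1)"
      have A: "A \<ge> 0" using nonneg[of x] elim by (simp add: A_def f_def)
      have G_le_Q: "G X t \<le> Q" for t
      proof (cases "t \<ge> 0")
        case True
        have "G X t \<le> X powr (- p) * ((K * t powr p + D) * exp (- (1 / X * t)))"
          using True KD(3)[of t] by (auto simp: G_def intro!: mult_left_mono mult_right_mono)
        also have "\<dots> = K * ((t / X) powr p * exp (- (t / X))) + D * (X powr (- p) * exp (- (t / X)))"
          using X True by (simp add: powr_divide powr_minus field_simps)
        also have "\<dots> \<le> K * p powr p + D * (1 * 1)"
          using KD X True p powr_mult_exp_le[of "t / X" p] ge_one_powr_ge_zero[of X p]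
          by (intro add_mono mult_left_mono mult_mono) (auto simp: powr_minus inverse_le_1_iff)
        finally show ?thesis by (simp add: Q_def)
      qed (use Q in \<open>simp add: G_def\<close>)
      have "G X (X - h * u) \<le> A + Q * (1 - indicator {-T..T} u)" for u
      proof (cases "u \<in> {-T..T}")
        case True
        have "h * \<bar>u\<bar> \<le> h * T"
          using True h by (intro mult_left_mono) auto
        then have "\<bar>h * u\<bar> \<le> \<epsilon>"
          using h by (simp add: abs_mult)
        then have t: "x \<le> X - h * u" "X - h * u \<le> x + 2 * \<epsilon>"
          unfolding X_def by linarith+
        have "a (X - h * u) \<le> exp (\<kappa> * (X - h * u - x)) * a x"
          using growth[of x "X - h * u"] elim t by simp
        also have "\<dots> \<le> exp (2 * \<kappa> * \<epsilon>) * a x"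
          using \<kappa> t nonneg[of x] elim by (intro mult_right_mono) auto
        finally have 1: "a (X - h * u) \<le> exp (2 * \<kappa> * \<epsilon>) * a x" .
        have "\<epsilon> \<le> \<epsilon> * X"
          using X \<epsilon> by simp
        then have "X - \<epsilon> * X \<le> X - h * u"
          using t X_def by linarith
        then have 2: "exp (- (1 / X * (X - h * u))) \<le> exp (\<epsilon> - 1)"
          using X by (simp add: field_simps)
        have "X powr (- p) \<le> x powr (- p)"
          using elim \<epsilon> p by (intro powr_mono2') (auto simp: X_def)
        then have "X powr (- p) * (a (X - h * u) * exp (- (1 / X * (X - h * u))))
            \<le> x powr (- p) * (exp (2 * \<kappa> * \<epsilon>) * a x * exp (\<epsilon> - 1))"
          using 1 2 nonneg[of x] nonneg[of "X - h * u"] elim t by (intro mult_mono) auto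
        then show ?thesis
          using True t elim(2) by (simp add: A_def G_def f_def mult_ac)
      qed (use A G_le_Q[of "X - h * u"] in simp)
      then have G_fejer: "G X (X - h * u) * fejer u \<le> (A + Q * (1 - indicator {-T..T} u)) * fejer u" for u
        by (rule mult_right_mono) (rule fejer_nonneg)
      have "G X (X - h * u) * fejer u \<le> A * fejer u + Q * (fejer u - indicator {-T..T} u * fejer u)" for u
        using G_fejer[of u] by (simp add: algebra_simps)
      then have "(\<integral>u. G X (X - h * u) * fejer u \<partial>lborel)
          \<le> (\<integral>u. A * fejer u + Q * (fejer u - indicator {-T..T} u * fejer u) \<partial>lborel)"
        by (intro integral_mono Bochner_Integration.integrable_add Bochner_Integration.integrable_diff
              integrable_mult_right int_V int_G integrable_fejer X h)
      also have "\<dots> = A * W + Q * (W - V T)"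
        unfolding W_def V_def using integrable_fejer int_V by simp
      also have "\<dots> \<le> A * W + Q * (\<epsilon> * W)"
        using T Q by (intro add_left_mono mult_left_mono) (auto simp: algebra_simps)
      finally have "(C - \<epsilon>) * exp (- 1) * W < (A + Q * \<epsilon>) * W"
        using elim(1) by (simp add: X_def algebra_simps)
      then have "(C - \<epsilon>) * exp (- 1) < A + Q * \<epsilon>"
        using W by simp
      then have "C - \<epsilon> < A * exp 1 + Q * \<epsilon> * exp 1"
        by (simp add: exp_minus field_simps)
      also have "A * exp 1 = f x * exp ((2 * \<kappa> + 1) * \<epsilon>)"
        by (simp add: A_def flip: exp_add add: algebra_simps)
      finally have "C - \<epsilon> - Q * exp 1 * \<epsilon> \<le> f x * exp ((2 * \<kappa> + 1) * \<epsilon>)"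
        by (simp add: algebra_simps)
      then have "L \<epsilon> \<le> f x * exp ((2 * \<kappa> + 1) * \<epsilon>) * exp (- ((2 * \<kappa> + 1) * \<epsilon>))"
        unfolding L_def by (rule mult_right_mono) simp
      then show ?case
        by (simp only: mult.assoc exp_add[symmetric]) simp
    qed
  qed
  have small: "\<forall>\<^sub>F \<epsilon>::real in at_right 0. 0 < \<epsilon> \<and> \<epsilon> < 1"
    by (simp add: eventually_at_right_field) (meson zero_less_one)
  \<comment> \<open>\<open>L\<close> and \<open>U\<close> both tend to \<open>C\<close> as
    \<open>\<epsilon>\<close> tends to 0, so one small \<open>\<epsilon>\<close> suffices for each
    strict bound on \<open>f\<close>.\<close>
  have "(f \<longlongrightarrow> C) at_top"
  proof (rule order_tendstoI)
    fix c assume "c < C"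
    have "(L \<longlongrightarrow> (C - 0 - Q * exp 1 * 0) * exp (- ((2 * \<kappa> + 1) * 0))) (at_right 0)"
      unfolding L_def by (intro tendsto_intros)
    then have "\<forall>\<^sub>F \<epsilon> in at_right 0. c < L \<epsilon>"
      by (rule order_tendstoD) (use \<open>c < C\<close> in simp)
    with small have "\<forall>\<^sub>F \<epsilon> in at_right 0. (0 < \<epsilon> \<and> \<epsilon> < 1) \<and> c < L \<epsilon>"
      by (rule eventually_conj)
    then obtain \<epsilon> where "0 < \<epsilon>" "\<epsilon> < 1" "c < L \<epsilon>"
      using eventually_happens'[OF trivial_limit_at_right_real] by blast
    with lower[of \<epsilon>] show "\<forall>\<^sub>F x in at_top. c < f x"
      by (auto elim: eventually_mono)
  next
    fix c assume "C < c"
    have "(U \<longlongrightarrow> (1 + 0) powr p * exp ((2 * \<kappa> + 1) * 0) / (1 - 0) * (C + 0)) (at_right 0)"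
      unfolding U_def by (intro tendsto_intros) auto
    then have "\<forall>\<^sub>F \<epsilon> in at_right 0. U \<epsilon> < c"
      by (rule order_tendstoD) (use \<open>C < c\<close> in simp)
    with small have "\<forall>\<^sub>F \<epsilon> in at_right 0. (0 < \<epsilon> \<and> \<epsilon> < 1) \<and> U \<epsilon> < c"
      by (rule eventually_conj)
    then obtain \<epsilon> where "0 < \<epsilon>" "\<epsilon> < 1" "U \<epsilon> < c"
      using eventually_happens'[OF trivial_limit_at_right_real] by blast
    with upper[of \<epsilon>] show "\<forall>\<^sub>F x in at_top. f x < c"
      by (auto elim: eventually_mono)
  qed
  then show ?thesis by (simp add: f_def)
qed

section \<open>Monotone functions with exponential weight\<close>

text \<open>Substituting \<open>z = \<mu> - s\<close> moves the line \<open>Re z = \<mu>\<close> to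
  \<open>Re s = 0\<close>. Nonnegativity makes the improper integrals absolutely convergent. With
  \<open>max 0 t\<close> the unknown values of \<open>\<phi>\<close> at negative arguments
  disappear, and the function becomes monotone, hence Borel, on the whole line.\<close>

lemma
  fixes \<phi> :: "real \<Rightarrow> real" and \<mu> :: real and L :: "complex \<Rightarrow> complex"
  defines "a \<equiv> (\<lambda>t. exp (\<mu> * t) * \<phi> (max 0 t))"
  assumes nonneg: "\<And>t. t \<ge> 0 \<Longrightarrow> \<phi> t \<ge> 0"
    and anti: "antimono_on {0..} \<phi>"
    and \<mu>: "\<mu> > 0"
    and lim: "\<And>z. 0 < Re z \<Longrightarrow> Re z < \<mu> \<Longrightarrow>
      has_improper_integral (\<lambda>t. exp (z * complex_of_real t) * complex_of_real (\<phi> t)) (L z)"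
  shows laplace_convergent_exp_shift: "laplace_convergent a"
    and laplace_exp_shift: "0 < Re s \<Longrightarrow> Re s < \<mu> \<Longrightarrow> laplace a s = L (of_real \<mu> - s)"
proof -
  have "mono (\<lambda>t. - \<phi> (max 0 t))"
    using anti by (auto intro!: monoI simp: monotone_on_def)
  then have "(\<lambda>t. - \<phi> (max 0 t)) \<in> borel_measurable borel"
    by (rule borel_measurable_mono)
  then have [measurable]: "(\<lambda>t. \<phi> (max 0 t)) \<in> borel_measurable borel"
    by simp
  then have [measurable]: "a \<in> borel_measurable borel"
    unfolding a_def by measurable
  have "set_integrable lborel {0..} (\<lambda>t. a t * exp (- (\<sigma> * t)))" if \<sigma>: "\<sigma> > 0" for \<sigma>
  proof -
    \<comment> \<open>A real exponent inside the strip with \<open>x \<ge> \<mu> - \<sigma>\<close>;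
      the minimum keeps it positive when \<open>\<sigma>\<close> is large.\<close>
    define x where "x = \<mu> - min \<sigma> (\<mu> / 2)"
    have x: "0 < x" "x < \<mu>" "\<mu> - \<sigma> \<le> x" using \<sigma> \<mu> by (auto simp: x_def)
    let ?g = "\<lambda>t. exp (x * t) * \<phi> (max 0 t)"
    have c: "has_improper_integral (\<lambda>t. exp (of_real x * complex_of_real t) * complex_of_real (\<phi> t)) (L (of_real x))"
      using lim[of "of_real x"] x by simp
    have Re_hi: "(?g has_integral Re (integral {0..R} (\<lambda>t. exp (of_real x * complex_of_real t) * complex_of_real (\<phi> t)))) {0..R}"
      if "R \<ge> 0" for R
    proof -
      have "((\<lambda>t. exp (of_real x * complex_of_real t) * complex_of_real (\<phi> t)) has_integral
          integral {0..R} (\<lambda>t. exp (of_real x * complex_of_real t) * complex_of_real (\<phi> t))) {0..R}"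
        using c that by (auto simp: has_improper_integral_def)
      from has_integral_linear[OF this bounded_linear_Re]
      show ?thesis
        by (rule has_integral_eq[rotated]) (auto simp: exp_of_real simp flip: of_real_mult)
    qed
    \<comment> \<open>At a real point the integrand is nonnegative, so convergence of the integrals
      over \<open>{0..R}\<close> yields integrability on the half-line.\<close>
    have "(?g has_integral Re (L (of_real x))) {0..}"
    proof (rule has_integral_to_inf)
      show "?g integrable_on {0..R}" for R
        using Re_hi[of R] by (cases "R \<ge> 0") (auto simp: integrable_on_def)
      have "((\<lambda>R. integral {0..R} (\<lambda>t. exp (of_real x * complex_of_real t) * complex_of_real (\<phi> t)))
          \<longlongrightarrow> L (of_real x)) at_top"
        using c by (simp add: has_improper_integral_def)
      from tendsto_Re[OF this] show "((\<lambda>R. integral {0..R} ?g) \<longlongrightarrow> Re (L (of_real x))) at_top"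
        by (rule Lim_transform_eventually)
           (auto intro!: eventually_at_top_linorderI[of 0] simp: integral_unique[OF Re_hi])
    qed (simp add: nonneg)
    then have int: "set_integrable lborel {0..} ?g"
      by (intro set_integrable_lborel_nonneg) (auto simp: nonneg integrable_on_def)
    show ?thesis
      unfolding set_integrable_def
    proof (rule Bochner_Integration.integrable_bound[OF int[unfolded set_integrable_def] _ AE_I2])
      fix t :: real
      show "norm (indicator {0..} t *\<^sub>R (a t * exp (- (\<sigma> * t)))) \<le> norm (indicator {0..} t *\<^sub>R ?g t)"
      proof (cases "t \<ge> 0")
        case True
        have "a t * exp (- (\<sigma> * t)) = exp ((\<mu> - \<sigma>) * t) * \<phi> t"
          using True by (simp add: a_def algebra_simps exp_diff exp_minus field_simps)
        also have "\<dots> \<le> exp (x * t) * \<phi> t"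
          using x True nonneg[of t] by (intro mult_right_mono) (auto intro: mult_right_mono)
        finally show ?thesis
          using True nonneg[of t] by (simp add: abs_mult a_def)
      qed simp
    qed measurable
  qed
  then show conv: "laplace_convergent a"
    by (simp add: laplace_convergent_def)
  assume s: "0 < Re s" "Re s < \<mu>"
  let ?E = "\<lambda>t. complex_of_real (a t) * exp (- (s * complex_of_real t))"
  have int: "set_integrable lborel {0..} ?E"
    using conv s(1) by (rule laplace_integrable)
  \<comment> \<open>\<open>laplace a s\<close> and \<open>L (of_real \<mu> - s)\<close> are limits
    of the same integrals over \<open>{0..R}\<close>, hence equal.\<close>
  have "((\<lambda>R. \<integral>t. indicator {..R} t *\<^sub>R (indicator {0..} t *\<^sub>R ?E t) \<partial>lborel) \<longlongrightarrow> laplace a s) at_top"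
    unfolding laplace_def set_lebesgue_integral_def
    using int by (intro tendsto_integral_at_top) (auto simp: set_integrable_def)
  moreover have "(\<integral>t. indicator {..R} t *\<^sub>R (indicator {0..} t *\<^sub>R ?E t) \<partial>lborel)
      = integral {0..R} (\<lambda>t. exp ((of_real \<mu> - s) * complex_of_real t) * complex_of_real (\<phi> t))" for R
  proof -
    have "(\<integral>t. indicator {..R} t *\<^sub>R (indicator {0..} t *\<^sub>R ?E t) \<partial>lborel) = (LINT t:{0..R}|lborel. ?E t)"
      unfolding set_lebesgue_integral_def by (intro Bochner_Integration.integral_cong) (auto simp: indicator_def)
    also have "\<dots> = integral {0..R} ?E"
      by (intro set_borel_integral_eq_integral set_integrable_subset[OF int]) auto
    also have "\<dots> = integral {0..R} (\<lambda>t. exp ((of_real \<mu> - s) * complex_of_real t) * complex_of_real (\<phi> t))"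
    proof (rule Henstock_Kurzweil_Integration.integral_cong)
      fix t assume "t \<in> {0..R}"
      then show "?E t = exp ((of_real \<mu> - s) * complex_of_real t) * complex_of_real (\<phi> t)"
        by (simp add: a_def algebra_simps exp_diff exp_minus divide_inverse flip: exp_of_real)
    qed
    finally show ?thesis .
  qed
  moreover have "((\<lambda>R. integral {0..R} (\<lambda>t. exp ((of_real \<mu> - s) * complex_of_real t) * complex_of_real (\<phi> t)))
      \<longlongrightarrow> L (of_real \<mu> - s)) at_top"
    using lim[of "of_real \<mu> - s"] s by (simp add: has_improper_integral_def)
  ultimately show "laplace a s = L (of_real \<mu> - s)"
    using tendsto_unique[OF trivial_limit_at_top_linorder] by simp
qed

text \<open>The lower bound comes from \<open>mono\<close>, the upper one from \<open>anti\<close>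
  together with \<open>t \<le> s * exp (t - s)\<close>, which uses \<open>s \<ge> 1\<close>. The
  rate \<open>\<mu> + 1 + \<nu>\<close> is large enough for both.\<close>

lemma times_exp_growth:
  fixes \<phi> :: "real \<Rightarrow> real"
  assumes nonneg: "\<And>t. t \<ge> 0 \<Longrightarrow> \<phi> t \<ge> 0"
    and anti: "antimono_on {0..} \<phi>"
    and \<mu>: "\<mu> > 0" and \<nu>: "\<nu> > 0"
    and mono: "mono_on {0..} (\<lambda>t. exp (\<nu> * t) * \<phi> t)"
    and s: "1 \<le> s" "s \<le> t"
  shows "exp (- ((\<mu> + 1 + \<nu>) * (t - s))) * (s * (exp (\<mu> * s) * \<phi> s)) \<le> t * (exp (\<mu> * t) * \<phi> t)"
    and "t * (exp (\<mu> * t) * \<phi> t) \<le> exp ((\<mu> + 1 + \<nu>) * (t - s)) * (s * (exp (\<mu> * s) * \<phi> s))"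
proof -
  have "exp (- ((\<mu> + 1 + \<nu>) * (t - s))) * (s * (exp (\<mu> * s) * \<phi> s))
      = s * (exp (- ((\<mu> + 1 + \<nu>) * (t - s)) + \<mu> * s - \<nu> * s) * (exp (\<nu> * s) * \<phi> s))"
  proof -
    have "exp (- ((\<mu> + 1 + \<nu>) * (t - s))) * exp (\<mu> * s)
        = exp (- ((\<mu> + 1 + \<nu>) * (t - s)) + \<mu> * s - \<nu> * s) * exp (\<nu> * s)"
      by (simp flip: exp_add)
    then have "(exp (- ((\<mu> + 1 + \<nu>) * (t - s))) * exp (\<mu> * s)) * (s * \<phi> s)
        = (exp (- ((\<mu> + 1 + \<nu>) * (t - s)) + \<mu> * s - \<nu> * s) * exp (\<nu> * s)) * (s * \<phi> s)"
      by (rule arg_cong)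
    then show ?thesis by (simp only: mult_ac)
  qed
  also have "\<dots> \<le> t * (exp (\<mu> * t - \<nu> * t) * (exp (\<nu> * t) * \<phi> t))"
  proof (intro mult_mono[OF _ mult_mono])
    \<comment> \<open>This is exactly the difference of the two exponents to be compared.\<close>
    have "0 \<le> (2 * \<mu> + 1) * (t - s)"
      using \<mu> s by simp
    then show "exp (- ((\<mu> + 1 + \<nu>) * (t - s)) + \<mu> * s - \<nu> * s) \<le> exp (\<mu> * t - \<nu> * t)"
      by (simp add: algebra_simps)
    show "exp (\<nu> * s) * \<phi> s \<le> exp (\<nu> * t) * \<phi> t"
      using mono s by (auto simp: monotone_on_def)
  qed (use s nonneg in auto)
  also have "\<dots> = t * (exp (\<mu> * t) * \<phi> t)"
    by (simp add: exp_diff)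
  finally show "exp (- ((\<mu> + 1 + \<nu>) * (t - s))) * (s * (exp (\<mu> * s) * \<phi> s)) \<le> t * (exp (\<mu> * t) * \<phi> t)" .
  \<comment> \<open>The difference of the two sides is \<open>(s - 1) * (t - s)\<close>.\<close>
  have "t \<le> s * (1 + (t - s))"
    using s mult_right_mono[of 1 s "t - s"] by (simp add: algebra_simps)
  also have "\<dots> \<le> s * exp (t - s)"
    using s exp_ge_add_one_self[of "t - s"] by (intro mult_left_mono) auto
  also have "\<dots> \<le> s * exp ((1 + \<nu>) * (t - s))"
    using s \<nu> by (simp add: mult_le_cancel_right1 algebra_simps mult_right_mono)
  finally have "t * (exp (\<mu> * t) * \<phi> t) \<le> s * exp ((1 + \<nu>) * (t - s)) * (exp (\<mu> * t) * \<phi> s)"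
    using anti s nonneg by (intro mult_mono) (auto simp: monotone_on_def)
  also have "\<dots> = exp ((\<mu> + 1 + \<nu>) * (t - s)) * (s * (exp (\<mu> * s) * \<phi> s))"
    by (simp add: algebra_simps exp_add exp_diff)
  finally show "t * (exp (\<mu> * t) * \<phi> t) \<le> exp ((\<mu> + 1 + \<nu>) * (t - s)) * (s * (exp (\<mu> * s) * \<phi> s))" .
qed

theorem proposition2p2:
  fixes \<phi> :: "real \<Rightarrow> real" and \<mu> \<nu> j :: real and F H :: "complex \<Rightarrow> complex"
  assumes "\<And>t. t \<ge> 0 \<Longrightarrow> \<phi> t \<ge> 0"
    and "antimono_on {0..} \<phi>"
    and "\<mu> > 0" and "\<nu> > 0"
    and "mono_on {0..} (\<lambda>t. exp (\<nu> * t) * \<phi> t)"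
    and "\<And>z. 0 < Re z \<Longrightarrow> Re z < \<mu> \<Longrightarrow>
           \<exists>L. has_improper_RS_integral (\<lambda>t. exp (z * complex_of_real t)) \<phi> L"
    and "j > 0"
    and "\<exists>U. open U \<and> {z. 0 < Re z \<and> Re z \<le> \<mu>} \<subseteq> U \<and> F holomorphic_on U"
    and "\<exists>U. open U \<and> {z. 0 < Re z \<and> Re z \<le> \<mu>} \<subseteq> U \<and> H holomorphic_on U"
    and "\<And>z. 0 < Re z \<Longrightarrow> Re z < \<mu> \<Longrightarrow>
           has_improper_integral
             (\<lambda>t. exp (z * complex_of_real t) * complex_of_real (\<phi> t))
             (F z / (complex_of_real \<mu> - z) powr complex_of_real j + H z)"
  shows "((\<lambda>t. complex_of_real (\<phi> t * t powr (1 - j) * exp (\<mu> * t)))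
           \<longlongrightarrow> F (complex_of_real \<mu>) / complex_of_real (Gamma j)) at_top"
proof -
  note nonneg = assms(1) and anti = assms(2) and \<mu> = assms(3) and \<nu> = assms(4) and mono = assms(5)
    and j = assms(7)
  obtain UF where UF: "open UF" "{z. 0 < Re z \<and> Re z \<le> \<mu>} \<subseteq> UF" "F holomorphic_on UF"
    using assms(8) by blast
  obtain UH where UH: "open UH" "{z. 0 < Re z \<and> Re z \<le> \<mu>} \<subseteq> UH" "H holomorphic_on UH"
    using assms(9) by blast
  define a where "a = (\<lambda>t. exp (\<mu> * t) * \<phi> (max 0 t))"
  define b where "b = (\<lambda>t. t * a t)"
  define c where "c = F (of_real \<mu>) / complex_of_real (Gamma j)"
  have conv: "laplace_convergent a"
    unfolding a_def by (rule laplace_convergent_exp_shift[OF nonneg anti \<mu> assms(10)])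
  then have conv_b: "laplace_convergent b"
    unfolding b_def by (rule laplace_convergent_times)
  have laplace_a: "laplace a s = F (of_real \<mu> - s) * s powr (- of_real j) + H (of_real \<mu> - s)"
    if "0 < Re s" "Re s < \<mu>" for s
    using laplace_exp_shift[OF nonneg anti \<mu> assms(10) that]
    by (simp add: a_def powr_minus divide_inverse)
  \<comment> \<open>By \<open>DERIV_laplace\<close> this is minus the derivative of
    \<open>laplace_a\<close>; differentiating the power produces the stronger singularity of order
    \<open>j + 1\<close>.\<close>
  have laplace_b: "laplace b s = deriv F (of_real \<mu> - s) * s powr (- of_real j)
      + of_real j * F (of_real \<mu> - s) * s powr (- of_real j - 1) + deriv H (of_real \<mu> - s)"
    if s: "0 < Re s" "Re s < \<mu>" for s
  proof -
    let ?S = "{s. 0 < Re s \<and> Re s < \<mu>}"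
    have "open ?S"
      by (intro open_Collect_conj open_halfspace_Re_gt open_halfspace_Re_lt)
    have F': "(F has_field_derivative deriv F (of_real \<mu> - s)) (at (of_real \<mu> - s))"
      using UF s by (intro holomorphic_derivI) auto
    have H': "(H has_field_derivative deriv H (of_real \<mu> - s)) (at (of_real \<mu> - s))"
      using UH s by (intro holomorphic_derivI) auto
    have sub: "((\<lambda>s. of_real \<mu> - s) has_field_derivative - 1) (at s)"
      by (auto intro!: derivative_eq_intros)
    have s': "s \<notin> \<real>\<^sub>\<le>\<^sub>0" using s by (auto simp: complex_nonpos_Reals_iff)
    have "((\<lambda>s. F (of_real \<mu> - s) * s powr (- of_real j) + H (of_real \<mu> - s)) has_field_derivative
        deriv F (of_real \<mu> - s) * (- 1) * s powr (- of_real j)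
        + (- of_real j * s powr (- of_real j - 1)) * F (of_real \<mu> - s) + deriv H (of_real \<mu> - s) * (- 1)) (at s)"
      by (intro DERIV_add DERIV_mult DERIV_chain2[OF F' sub] DERIV_chain2[OF H' sub]
            has_field_derivative_powr s')
    then have "(laplace a has_field_derivative
        deriv F (of_real \<mu> - s) * (- 1) * s powr (- of_real j)
        + (- of_real j * s powr (- of_real j - 1)) * F (of_real \<mu> - s) + deriv H (of_real \<mu> - s) * (- 1)) (at s)"
      by (rule has_field_derivative_transform_within_open[OF _ \<open>open ?S\<close>]) (use s laplace_a in auto)
    from DERIV_unique[OF DERIV_laplace[OF conv s(1)] this]
    show ?thesis
      unfolding b_def by (simp add: algebra_simps minus_equation_iff[of "laplace _ _"])
  qed
  \<comment> \<open>Subtracting the comparison transform replaces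
    \<open>F (of_real \<mu> - s)\<close> in the leading term by its difference from
    \<open>F (of_real \<mu>)\<close>, which is \<open>O(norm s)\<close> and lowers the order of the
    singularity to \<open>j\<close>.\<close>
  have bound: "\<exists>B. \<forall>s. 0 < Re s \<longrightarrow> Re s < \<mu> / 2 \<longrightarrow> \<bar>Im s\<bar> \<le> 1 / h \<longrightarrow>
      norm (laplace b s - c * laplace (\<lambda>t. t powr j) s) \<le> B * (norm s powr (- j) + 1)" if h: "h > 0" for h
  proof -
    \<comment> \<open>A compact convex rectangle holding \<open>\<mu>\<close> and all
      \<open>\<mu> - s\<close> in question. The restriction \<open>Re s < \<mu> / 2\<close> keeps it
      off the line \<open>Re z = 0\<close>; its side on \<open>Re z = \<mu>\<close> lies in both
      domains.\<close>
    define K where "K = cbox (Complex (\<mu> / 2) (- 1 / h)) (Complex \<mu> (1 / h))"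
    have K: "K \<subseteq> UF" "K \<subseteq> UH"
      using UF(2) UH(2) \<mu> by (auto simp: K_def in_cbox_complex_iff)
    have bdd: "\<exists>B\<ge>0. \<forall>z\<in>K. norm (deriv f z) \<le> B" if "open U" "f holomorphic_on U" "K \<subseteq> U" for f U
    proof -
      have "continuous_on K (deriv f)"
        using that by (meson continuous_on_subset holomorphic_deriv holomorphic_on_imp_continuous_on)
      then have "bounded (deriv f ` K)"
        unfolding K_def by (intro compact_imp_bounded compact_continuous_image compact_cbox)
      then obtain B where "\<And>z. z \<in> K \<Longrightarrow> norm (deriv f z) \<le> B"
        unfolding bounded_iff by auto
      then show ?thesis
        by (intro exI[of _ "max 0 B"]) (auto intro: le_max_iff_disj[THEN iffD2])
    qed
    obtain B1 where B1: "B1 \<ge> 0" "\<And>z. z \<in> K \<Longrightarrow> norm (deriv F z) \<le> B1"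
      using bdd[OF UF(1,3) K(1)] by blast
    obtain B2 where B2: "B2 \<ge> 0" "\<And>z. z \<in> K \<Longrightarrow> norm (deriv H z) \<le> B2"
      using bdd[OF UH(1,3) K(2)] by blast
    show ?thesis
    proof (intro exI[of _ "B1 + j * B1 + B2"] allI impI)
      fix s assume s: "0 < Re s" "Re s < \<mu> / 2" "\<bar>Im s\<bar> \<le> 1 / h"
      have s0: "s \<noteq> 0" using s by auto
      have zK: "of_real \<mu> - s \<in> K" "of_real \<mu> \<in> K"
        using s \<mu> h by (auto simp: K_def in_cbox_complex_iff abs_le_iff)
      have "norm (F (of_real \<mu> - s) - F (of_real \<mu>)) \<le> B1 * norm (of_real \<mu> - s - of_real \<mu>)"
      proof (rule field_differentiable_bound[of K])
        show "convex K" unfolding K_def by (rule convex_box)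
        show "(F has_field_derivative deriv F z) (at z within K)" if "z \<in> K" for z
          using UF K that by (intro DERIV_subset[OF holomorphic_derivI[OF UF(3,1)]]) auto
      qed (use B1 zK in auto)
      then have Fd: "norm (F (of_real \<mu> - s) - F (of_real \<mu>)) \<le> B1 * norm s"
        by simp
      \<comment> \<open>The denominator \<open>Gamma j\<close> of \<open>c\<close> is made for this:
        \<open>Gamma (j + 1) = j * Gamma j\<close> leaves the leading coefficient of
        \<open>laplace_b\<close> at \<open>s = 0\<close>.\<close>
      have "c * laplace (\<lambda>t. t powr j) s = of_real j * F (of_real \<mu>) * s powr (- of_real j - 1)"
      proof -
        have "Gamma (j + 1) = j * Gamma j"
          using j by (intro Gamma_plus1) (auto elim!: nonpos_Ints_cases)
        moreover have "Gamma j \<noteq> 0"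
          using Gamma_real_pos[OF j] by simp
        ultimately show ?thesis
          using laplace_powr[OF j s(1)] by (simp add: c_def)
      qed
      then have "laplace b s - c * laplace (\<lambda>t. t powr j) s = deriv F (of_real \<mu> - s) * s powr (- of_real j)
          + of_real j * (F (of_real \<mu> - s) - F (of_real \<mu>)) * s powr (- of_real j - 1) + deriv H (of_real \<mu> - s)"
        using laplace_b[of s] s \<mu> by (simp add: algebra_simps)
      also have "norm \<dots> \<le> norm (deriv F (of_real \<mu> - s)) * norm s powr (- j)
          + j * norm (F (of_real \<mu> - s) - F (of_real \<mu>)) * norm s powr (- j - 1) + norm (deriv H (of_real \<mu> - s))"
        using j norm_powr_real_powr'[of "- of_real j - 1" s] norm_powr_real_powr'[of "- of_real j" s]
        by (intro order_trans[OF norm_triangle_ineq] add_mono) (auto simp: norm_mult)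
      also have "\<dots> \<le> B1 * norm s powr (- j) + j * (B1 * norm s) * norm s powr (- j - 1) + B2"
        using B1 B2 zK Fd j by (intro add_mono mult_right_mono mult_left_mono) auto
      also have "j * (B1 * norm s) * norm s powr (- j - 1) = j * B1 * norm s powr (- j)"
        using s0 powr_mult_base[of "norm s" "- j - 1"] by simp
      also have "B1 * norm s powr (- j) + j * B1 * norm s powr (- j) + B2
          \<le> (B1 + j * B1 + B2) * (norm s powr (- j) + 1)"
        using B1 B2 j by (simp add: algebra_simps)
      finally show "norm (laplace b s - c * laplace (\<lambda>t. t powr j) s)
          \<le> (B1 + j * B1 + B2) * (norm s powr (- j) + 1)" .
    qed
  qed
  let ?W = "\<integral>u. fejer u \<partial>lborel"
  let ?M = "\<lambda>h x. x powr (- j) * (LINT t:{0..}|lborel. b t * exp (- (1 / x * t)) * fejer ((x - t) / h))"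
  have lim: "((\<lambda>x. complex_of_real (?M h x)) \<longlongrightarrow> c * complex_of_real (exp (- 1) * h * ?W)) at_top"
    if h: "h > 0" for h
  proof -
    obtain B where "\<And>s. 0 < Re s \<Longrightarrow> Re s < \<mu> / 2 \<Longrightarrow> \<bar>Im s\<bar> \<le> 1 / h \<Longrightarrow>
        norm (laplace b s - c * laplace (\<lambda>t. t powr j) s) \<le> B * (norm s powr (- j) + 1)"
      using bound[OF h] by blast
    then show ?thesis
      using \<mu> by (intro laplace_fejer_tendsto[OF conv_b j h, of "\<mu> / 2"]) auto
  qed
  \<comment> \<open>The averages of \<open>b\<close> are real, hence so is their limit;
    \<open>fejer_tauberian\<close> works with a real constant.\<close>
  have "Im c = 0"
  proof -
    have "((\<lambda>x::real. 0::real) \<longlongrightarrow> Im c * (exp (- 1) * 1 * ?W)) at_top"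
      using tendsto_Im[OF lim[of 1]] by simp
    then have "Im c * (exp (- 1) * 1 * ?W) = 0"
      by (simp add: tendsto_const_iff)
    then show ?thesis using fejer_integral_pos by simp
  qed
  then have c: "c = of_real (Re c)"
    by (simp add: complex_eq_iff)
  have a_eq: "a t = exp (\<mu> * t) * \<phi> t" if "t \<ge> 0" for t
    using that by (simp add: a_def)
  have "((\<lambda>t. b t * t powr (- j)) \<longlongrightarrow> Re c) at_top"
  proof (rule fejer_tauberian[OF conv_b, where \<kappa> = "\<mu> + 1 + \<nu>"])
    show "b t \<ge> 0" if "t \<ge> 0" for t
      using that nonneg[of t] by (simp add: b_def a_eq)
    show "\<exists>D. \<forall>t\<in>{0..T}. b t \<le> D" for T
    proof (intro exI ballI)
      fix t assume t: "t \<in> {0..T}"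
      have "\<phi> t \<le> \<phi> 0"
        using anti t by (auto simp: monotone_on_def)
      then show "b t \<le> T * (exp (\<mu> * T) * \<phi> 0)"
        using t nonneg[of t] \<mu> unfolding b_def by (subst a_eq) (auto intro!: mult_mono)
    qed
    show "((\<lambda>x. ?M h x) \<longlongrightarrow> Re c * (exp (- 1) * h * ?W)) at_top" if "h > 0" for h
      using tendsto_Re[OF lim[OF that]] by simp
    show "exp (- ((\<mu> + 1 + \<nu>) * (t - s))) * b s \<le> b t \<and> b t \<le> exp ((\<mu> + 1 + \<nu>) * (t - s)) * b s"
      if "1 \<le> s" "s \<le> t" for s t
      using times_exp_growth[OF nonneg anti \<mu> \<nu> mono that] that by (simp add: b_def a_eq)
  qed (use \<mu> \<nu> j in auto)
  then have "((\<lambda>t. complex_of_real (b t * t powr (- j))) \<longlongrightarrow> c) at_top"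
    by (subst c) (rule tendsto_of_real)
  \<comment> \<open>The extra factor \<open>t\<close> in \<open>b\<close> turns
    \<open>t powr (- j)\<close> into \<open>t powr (1 - j)\<close>.\<close>
  moreover have "\<forall>\<^sub>F t in at_top. complex_of_real (b t * t powr (- j)) =
      complex_of_real (\<phi> t * t powr (1 - j) * exp (\<mu> * t))"
    using eventually_gt_at_top[of 0]
    by eventually_elim (simp add: b_def a_eq powr_diff powr_minus field_simps)
  ultimately show ?thesis
    unfolding c_def by (rule Lim_transform_eventually)
qed

end
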